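(* Let $H$ be a complex Hilbert space with $\dim H\geq 2$ and let $\phi:E(H)\to E(H)$ be a bijective map which preserves the order in both directions, i.e., $A\leq B\Longleftrightarrow\phi(A)\leq\phi(B)$ for all $A,B\in E(H)$. Suppose that there is a scalar $\lambda\in\,]0,1[$ such that $\phi(\lambda I)=\lambda I$. Then there exists an either unitary or antiunitary operator $U$ on $H$ such that \[ \phi(A)=UAU^*\qquad (A\in E(H)). \]
   Context: $E(H)$ denotes the set of all (Hilbert space) effects on $H$, i.e., all positive bounded linear operators $A$ on $H$ with $0\leq A\leq I$, where $I$ is the identity. The order $\leq$ is the usual order among self-adjoint bounded linear operators. $]0,1[$ is the open unit interval. *)

theory Defs
  imports "HOL-Analysis.Analysis"
begin

text \<open>The complex inner product is linear in its first argument.  Positive definiteness and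
  the identity of the norm with \<open>sqrt (Re (cinner x x))\<close> are inherited from \<^class>\<open>real_inner\<close>
  through \<open>Re_cinner\<close>; the unit law of the scalar multiplication is inherited through
  \<open>scaleC_of_real\<close>.\<close>

class complex_inner = real_inner +
  fixes scaleC :: "complex \<Rightarrow> 'a \<Rightarrow> 'a" (infixr "*\<^sub>C" 75)
    and cinner :: "'a \<Rightarrow> 'a \<Rightarrow> complex"
  assumes scaleC_add_right: "a *\<^sub>C (x + y) = a *\<^sub>C x + a *\<^sub>C y"
    and scaleC_add_left: "(a + b) *\<^sub>C x = a *\<^sub>C x + b *\<^sub>C x"
    and scaleC_scaleC: "a *\<^sub>C b *\<^sub>C x = (a * b) *\<^sub>C x"
    and scaleC_of_real: "complex_of_real r *\<^sub>C x = r *\<^sub>R x"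
    and cinner_commute: "cinner x y = cnj (cinner y x)"
    and cinner_add_left: "cinner (x + y) z = cinner x z + cinner y z"
    and cinner_scaleC_left: "cinner (a *\<^sub>C x) y = a * cinner x y"
    and Re_cinner: "Re (cinner x y) = inner x y"

class chilbert_space = complex_inner + complete_space

global_interpretation complex_vector: vector_space "scaleC :: complex \<Rightarrow> 'a \<Rightarrow> 'a::complex_inner"
proof
  show "1 *\<^sub>C x = x" for x :: 'a
    using scaleC_of_real[of 1 x] by simp
qed (fact scaleC_add_right scaleC_add_left scaleC_scaleC)+

definition orthonormal_basis :: "'a::chilbert_space set \<Rightarrow> bool" where
  "orthonormal_basis B \<longleftrightarrow>
     (\<forall>x\<in>B. \<forall>y\<in>B. cinner x y = (if x = y then 1 else 0)) \<and>
     closure (complex_vector.span B) = UNIV"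

definition bounded_clinear :: "('a::chilbert_space \<Rightarrow> 'a) \<Rightarrow> bool" where
  "bounded_clinear A \<longleftrightarrow> bounded_linear A \<and> (\<forall>c x. A (c *\<^sub>C x) = c *\<^sub>C A x)"

definition bounded_antilinear :: "('a::chilbert_space \<Rightarrow> 'a) \<Rightarrow> bool" where
  "bounded_antilinear A \<longleftrightarrow> bounded_linear A \<and> (\<forall>c x. A (c *\<^sub>C x) = cnj c *\<^sub>C A x)"

text \<open>The adjoint of a bounded linear operator and that of a bounded antilinear operator are
  characterized by different identities.\<close>

definition cadjoint :: "('a::chilbert_space \<Rightarrow> 'a) \<Rightarrow> 'a \<Rightarrow> 'a" where
  "cadjoint A = (SOME B. \<forall>x y. cinner (A x) y = cinner x (B y))"

definition antiadjoint :: "('a::chilbert_space \<Rightarrow> 'a) \<Rightarrow> 'a \<Rightarrow> 'a" where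
  "antiadjoint A = (SOME B. \<forall>x y. cinner (A x) y = cnj (cinner x (B y)))"

lemma cinner_ext:
  fixes u v :: "'a::complex_inner"
  assumes "\<And>x. cinner x u = cinner x v"
  shows "u = v"
proof -
  have "inner x u = inner x v" for x
    unfolding Re_cinner[symmetric] by (rule arg_cong[OF assms])
  then have "inner (u - v) (u - v) = 0"
    unfolding inner_diff_right right_minus_eq .
  then show ?thesis
    by simp
qed

lemma cadjoint_eqI:
  assumes "\<And>x y. cinner (A x) y = cinner x (B y)"
  shows "cadjoint A = B"
  unfolding cadjoint_def
proof (rule some_equality)
  fix C assume C: "\<forall>x y. cinner (A x) y = cinner x (C y)"
  have "cinner x (C y) = cinner x (B y)" for x y
    using C[rule_format, of x y] assms[of x y] by (rule trans[OF sym])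
  then show "C = B"
    by (intro ext cinner_ext)
qed (intro allI assms)

lemma antiadjoint_eqI:
  assumes "\<And>x y. cinner (A x) y = cnj (cinner x (B y))"
  shows "antiadjoint A = B"
  unfolding antiadjoint_def
proof (rule some_equality)
  fix C assume C: "\<forall>x y. cinner (A x) y = cnj (cinner x (C y))"
  have "cnj (cinner x (C y)) = cnj (cinner x (B y))" for x y
    using C[rule_format, of x y] assms[of x y] by (rule trans[OF sym])
  then have "cinner x (C y) = cinner x (B y)" for x y
    by (simp only: complex_cnj_cancel_iff)
  then show "C = B"
    by (intro ext cinner_ext)
qed (intro allI assms)

definition unitary :: "('a::chilbert_space \<Rightarrow> 'a) \<Rightarrow> bool" where
  "unitary U \<longleftrightarrow> bounded_clinear U \<and> cadjoint U \<circ> U = id \<and> U \<circ> cadjoint U = id"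

definition antiunitary :: "('a::chilbert_space \<Rightarrow> 'a) \<Rightarrow> bool" where
  "antiunitary U \<longleftrightarrow> bounded_antilinear U \<and> antiadjoint U \<circ> U = id \<and> U \<circ> antiadjoint U = id"

definition self_adjoint :: "('a::chilbert_space \<Rightarrow> 'a) \<Rightarrow> bool" where
  "self_adjoint A \<longleftrightarrow> bounded_clinear A \<and> (\<forall>x y. cinner (A x) y = cinner x (A y))"

text \<open>Only used for self-adjoint operators, whose quadratic forms are real-valued.\<close>

definition op_le :: "('a::chilbert_space \<Rightarrow> 'a) \<Rightarrow> ('a \<Rightarrow> 'a) \<Rightarrow> bool" (infix "\<preceq>" 50) where
  "A \<preceq> B \<longleftrightarrow> (\<forall>x. Re (cinner (A x) x) \<le> Re (cinner (B x) x))"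

definition effects :: "('a::chilbert_space \<Rightarrow> 'a) set" where
  "effects = {A. self_adjoint A \<and> (\<lambda>_. 0) \<preceq> A \<and> A \<preceq> id}"

end

theory Submission
  imports Defs
begin

text \<open>
  The rank-one effects \<open>t|q><q|\<close>, where \<open>q\<close> is a unit vector, are visible in the order: the effects
  between \<open>C\<close> and \<open>A\<close> form a chain exactly if \<open>A - C\<close> has rank at most one
  (\<open>order_chain_imp_dyad\<close>, \<open>order_chain_dyad\<close>).  They also determine the order
  (\<open>op_le_by_dyads\<close>).  Both facts rest on the Cauchy--Schwarz inequality for the form of a positive
  operator, which takes the place of square roots and spectral theory.

  Hence \<open>\<phi>\<close> acts on lines, \<open>q \<mapsto> \<psi> q\<close>, and moves the weight \<open>t\<close> on each line.  The fixed operator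
  \<open>l I\<close> ties the lines together: the operators \<open>l I + s|p><p|\<close> are mapped to operators
  \<open>l I + s'|\<psi> p><\<psi> p|\<close>, and on a suitable scale \<open>x\<close> of the weights between \<open>l\<close> and \<open>1\<close> the
  comparison of a dyad on the line of \<open>q\<close> with such an operator reads \<open>x \<le> c y\<close>, where
  \<open>c = \<bar><p, q>\<bar>\<^sup>2\<close>.  Preservation of this comparison yields \<open>G\<^sub>q(c y) = c' G\<^sub>p(y)\<close> with
  \<open>c' = \<bar><\<psi> p, \<psi> q>\<bar>\<^sup>2\<close> for the rescalings \<open>G\<^sub>q\<close> of \<open>[0, 1]\<close> (\<open>rescaling_transition\<close>).  In
  particular \<open>\<psi>\<close> preserves orthogonality.  Two orthogonal lines in a plane give
  \<open>G\<^sub>q(1 - x) = 1 - G\<^sub>q(x)\<close>, the overlap \<open>c = 1/2\<close> gives \<open>G\<^sub>q(y/2) = G\<^sub>p(y)/2\<close>, and these two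
  equations force every \<open>G\<^sub>q\<close> to be the identity (\<open>rescaling_id\<close>).  So \<open>\<psi>\<close> preserves transition
  probabilities, and \<open>\<phi>\<close> preserves the weights that are at least \<open>l\<close>.

  Wigner's theorem (\<open>wigner\<close>) provides a unitary or antiunitary \<open>U\<close> that induces \<open>\<psi>\<close>.  After
  conjugation by the inverse of \<open>U\<close>, the automorphism fixes all dyads of weight at least \<open>l\<close>,
  therefore all effects above \<open>l I\<close>.  The dual automorphism \<open>A \<mapsto> I - \<phi>(I - A)\<close> of the conjugated one
  then fixes all effects below \<open>(1 - l) I\<close>, and by the same result on weights, applied to the dual
  and \<open>1 - l\<close>, all dyads.  So the conjugated automorphism is the identity
  (\<open>identity_if_fixes_heavy_dyads\<close>).
\<close>

section \<open>Complex inner products and bounded operators\<close>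

lemma cinner_add_right: "cinner x (y + z) = cinner x y + cinner x (z::'a::complex_inner)"
  by (metis cinner_add_left cinner_commute complex_cnj_add)

lemma cinner_scaleC_right: "cinner x (c *\<^sub>C y) = cnj c * cinner x (y::'a::complex_inner)"
  by (metis cinner_commute cinner_scaleC_left complex_cnj_mult)

lemma cinner_scaleR_left: "cinner (r *\<^sub>R x) y = r * cinner x (y::'a::complex_inner)"
  using cinner_scaleC_left[of "of_real r" x y] by (simp add: scaleC_of_real)

lemma cinner_scaleR_right: "cinner x (r *\<^sub>R y) = r * cinner x (y::'a::complex_inner)"
  using cinner_scaleC_right[of x "of_real r" y] by (simp add: scaleC_of_real)

lemma cinner_minus_left: "cinner (- x) y = - cinner x (y::'a::complex_inner)"
  using cinner_scaleR_left[of "-1" x y] by simp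

lemma cinner_minus_right: "cinner x (- y) = - cinner x (y::'a::complex_inner)"
  using cinner_scaleR_right[of x "-1" y] by simp

lemma cinner_diff_left: "cinner (x - y) z = cinner x z - cinner y (z::'a::complex_inner)"
  using cinner_add_left[of x "-y" z] by (simp add: cinner_minus_left)

lemma cinner_diff_right: "cinner x (y - z) = cinner x y - cinner x (z::'a::complex_inner)"
  using cinner_add_right[of x y "-z"] by (simp add: cinner_minus_right)

lemma cinner_zero_left [simp]: "cinner 0 (y::'a::complex_inner) = 0"
  using cinner_scaleR_left[of 0 0 y] by simp

lemma cinner_zero_right [simp]: "cinner (y::'a::complex_inner) 0 = 0"
  using cinner_scaleR_right[of y 0 0] by simp

lemmas cinner_algebra = cinner_add_left cinner_add_right cinner_diff_left cinner_diff_right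
  cinner_scaleC_left cinner_scaleC_right cinner_scaleR_left cinner_scaleR_right
  cinner_minus_left cinner_minus_right

lemma cinner_self: "cinner x x = of_real ((norm (x::'a::complex_inner))\<^sup>2)"
proof (rule complex_eqI)
  show "Re (cinner x x) = Re (of_real ((norm x)\<^sup>2))"
    by (simp add: Re_cinner power2_norm_eq_inner)
  have "Im (cinner x x) = - Im (cinner x x)"
    by (metis cinner_commute cnj.simps(2))
  then show "Im (cinner x x) = Im (of_real ((norm x)\<^sup>2))" by simp
qed

lemma cinner_self_unit: "norm (x::'a::complex_inner) = 1 \<Longrightarrow> cinner x x = 1"
  by (simp add: cinner_self)

lemma Im_cinner: "Im (cinner x y) = x \<bullet> (\<i> *\<^sub>C (y::'a::complex_inner))"
  by (simp add: Re_cinner[symmetric] cinner_scaleC_right)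

lemma cmod_cinner_commute: "cmod (cinner x y) = cmod (cinner y (x::'a::complex_inner))"
  by (metis cinner_commute complex_mod_cnj)

lemma mult_cnj_self: "z * cnj z = (of_real (cmod z))\<^sup>2" "cnj z * z = (of_real (cmod z))\<^sup>2"
  by (simp_all add: complex_norm_square[symmetric] mult.commute)

lemma norm_scaleC: "norm (c *\<^sub>C x) = cmod c * norm (x::'a::complex_inner)"
proof -
  have "complex_of_real ((norm (c *\<^sub>C x))\<^sup>2) = of_real ((cmod c * norm x)\<^sup>2)"
    unfolding cinner_self[symmetric] cinner_scaleC_left cinner_scaleC_right
    by (simp add: cinner_self power_mult_distrib mult_cnj_self mult.assoc[symmetric])
  then show ?thesis
    unfolding of_real_eq_iff by (rule power2_eq_imp_eq) simp_all
qed

lemma scaleC_scaleR: "c *\<^sub>C (r *\<^sub>R x) = r *\<^sub>R (c *\<^sub>C (x::'a::complex_inner))"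
  by (simp add: scaleC_of_real[symmetric] scaleC_scaleC mult.commute)

lemma scaleC_of_real_mult:
  "(of_real r * c) *\<^sub>C x = r *\<^sub>R c *\<^sub>C (x::'a::complex_inner)"
  by (simp only: scaleC_scaleC[symmetric] scaleC_of_real)

lemma exists_phase: "\<exists>u. cmod u = 1 \<and> u * z = of_real (cmod z)"
proof (cases "z = 0")
  case False
  then show ?thesis
    by (intro exI[of _ "cnj z / of_real (cmod z)"])
       (simp add: norm_divide mult_cnj_self power2_eq_square)
qed (auto intro: exI[of _ 1])

lemma op_le_iff: "A \<preceq> B \<longleftrightarrow> (\<forall>x. A x \<bullet> x \<le> B x \<bullet> x)"
  by (simp add: op_le_def Re_cinner)

lemma op_le_refl: "A \<preceq> A"
  by (simp add: op_le_iff)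

lemma op_le_trans: "A \<preceq> B \<Longrightarrow> B \<preceq> C \<Longrightarrow> A \<preceq> C"
  unfolding op_le_iff using order_trans by blast

lemma self_adjoint_cinner: "self_adjoint A \<Longrightarrow> cinner (A x) y = cinner x (A y)"
  by (simp add: self_adjoint_def)

lemma self_adjoint_inner: "self_adjoint A \<Longrightarrow> A x \<bullet> y = x \<bullet> A y"
  by (metis self_adjoint_cinner Re_cinner)

lemma self_adjoint_bounded: "self_adjoint A \<Longrightarrow> bounded_linear A"
  by (simp add: self_adjoint_def bounded_clinear_def)

lemma self_adjoint_scaleC: "self_adjoint A \<Longrightarrow> A (c *\<^sub>C x) = c *\<^sub>C A x"
  by (simp add: self_adjoint_def bounded_clinear_def)

lemma self_adjoint_add: "self_adjoint A \<Longrightarrow> A (x + y) = A x + A y"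
  by (simp add: self_adjoint_bounded bounded_linear.linear linear_add)

lemma self_adjoint_diff: "self_adjoint A \<Longrightarrow> A (x - y) = A x - A y"
  by (simp add: self_adjoint_bounded bounded_linear.linear linear_diff)

lemma self_adjoint_scaleR: "self_adjoint A \<Longrightarrow> A (r *\<^sub>R x) = r *\<^sub>R A x"
  by (simp add: self_adjoint_bounded bounded_linear.linear linear_scale)

lemma self_adjoint_cinner_self: "self_adjoint A \<Longrightarrow> cinner (A x) x = of_real (A x \<bullet> x)"
proof (rule complex_eqI)
  assume A: "self_adjoint A"
  have "Im (cinner (A x) x) = - Im (cinner (A x) x)"
    by (metis A self_adjoint_cinner cinner_commute cnj.simps(2))
  then show "Im (cinner (A x) x) = Im (of_real (A x \<bullet> x))" by simp
qed (simp add: Re_cinner)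

text \<open>Symmetry for the real inner product suffices because the imaginary part of the complex one
  is the real one twisted by \<open>\<i>\<close>, which commutes with the operator.  This lets linear and
  antilinear conjugations be treated alike.\<close>

lemma self_adjointI:
  assumes "bounded_linear A" and C: "\<And>c x. A (c *\<^sub>C x) = c *\<^sub>C A x"
    and R: "\<And>x y. A x \<bullet> y = x \<bullet> A y"
  shows "self_adjoint A"
proof -
  have "cinner (A x) y = cinner x (A y)" for x y
    by (rule complex_eqI) (simp_all add: Re_cinner Im_cinner R C)
  then show ?thesis
    using assms by (simp add: self_adjoint_def bounded_clinear_def)
qed

lemma self_adjoint_plus:
  assumes "self_adjoint A" "self_adjoint B" shows "self_adjoint (\<lambda>x. A x + B x)"
  using assms by (intro self_adjointI bounded_linear_add)
    (auto simp: self_adjoint_bounded self_adjoint_scaleC self_adjoint_inner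
       complex_vector.scale_right_distrib inner_add_left inner_add_right)

lemma self_adjoint_minus:
  assumes "self_adjoint A" "self_adjoint B" shows "self_adjoint (\<lambda>x. A x - B x)"
  using assms by (intro self_adjointI bounded_linear_sub)
    (auto simp: self_adjoint_bounded self_adjoint_scaleC self_adjoint_inner
       complex_vector.scale_right_diff_distrib inner_diff_left inner_diff_right)

lemma self_adjoint_scalar: "self_adjoint (\<lambda>x. r *\<^sub>R x)"
  by (intro self_adjointI bounded_linear_scaleR_right) (auto simp: scaleC_scaleR)

text \<open>By polarization, a self-adjoint operator with zero quadratic form vanishes.\<close>

lemma op_le_antisym:
  assumes A: "self_adjoint A" and B: "self_adjoint B" and "A \<preceq> B" "B \<preceq> A"
  shows "A = B"
proof -
  define D where "D = (\<lambda>x. A x - B x)"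
  have D: "self_adjoint D" unfolding D_def using A B by (rule self_adjoint_minus)
  have Q: "D x \<bullet> x = 0" for x
    using assms(3,4) by (simp add: op_le_iff D_def inner_diff_left order_antisym)
  have "D x \<bullet> y = 0" for x y
    using Q[of "x + y"] Q[of x] Q[of y] self_adjoint_inner[OF D, of y x]
    by (simp add: self_adjoint_add[OF D] inner_add_left inner_add_right inner_commute)
  then have "D x = 0" for x by (metis inner_eq_zero_iff)
  then show ?thesis by (auto simp: D_def)
qed

definition positive :: "('a::chilbert_space \<Rightarrow> 'a) \<Rightarrow> bool" where
  "positive D \<longleftrightarrow> self_adjoint D \<and> (\<forall>x. 0 \<le> D x \<bullet> x)"

lemma positive_self_adjoint: "positive D \<Longrightarrow> self_adjoint D"
  by (simp add: positive_def)

text \<open>The Cauchy--Schwarz inequality of the semi-inner product defined by a positive operator.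
  Rotating \<open>x\<close> by a phase reduces it to the real inequality, which is the
  nonnegativity of the quadratic form on a real line.\<close>

lemma positive_Cauchy_Schwarz:
  assumes D: "positive D"
  shows "(cmod (cinner (D x) y))\<^sup>2 \<le> (D x \<bullet> x) * (D y \<bullet> y)"
proof -
  note sa = positive_self_adjoint[OF D]
  have real: "(D x \<bullet> y)\<^sup>2 \<le> (D x \<bullet> x) * (D y \<bullet> y)" for x
  proof -
    define a b c where "a = D x \<bullet> x" and "b = D x \<bullet> y" and "c = D y \<bullet> y"
    have q: "0 \<le> a + 2 * s * b + s\<^sup>2 * c" for s
    proof -
      have "0 \<le> D (x + s *\<^sub>R y) \<bullet> (x + s *\<^sub>R y)" using D by (simp add: positive_def)
      also have "\<dots> = a + 2 * s * b + s\<^sup>2 * c"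
        using self_adjoint_inner[OF sa, of y x]
        by (simp add: a_def b_def c_def self_adjoint_add[OF sa] self_adjoint_scaleR[OF sa]
            inner_add_left inner_add_right inner_commute power2_eq_square algebra_simps)
      finally show ?thesis .
    qed
    have "b\<^sup>2 \<le> a * c"
    proof (cases "c = 0")
      case True
      have "b = 0"
      proof (rule ccontr)
        assume "b \<noteq> 0"
        then show False using q[of "- (a + 1) / (2 * b)"] True by (simp add: field_simps)
      qed
      then show ?thesis using True by simp
    next
      case False
      then have "c > 0" using D by (simp add: c_def positive_def order_less_le)
      moreover have "0 \<le> c * (a + 2 * (- b / c) * b + (- b / c)\<^sup>2 * c)"
        using q[of "- b / c"] \<open>c > 0\<close> by simp
      ultimately show ?thesis by (simp add: power2_eq_square field_simps)
    qed
    then show ?thesis by (simp add: a_def b_def c_def)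
  qed
  obtain u where u: "cmod u = 1" "u * cinner (D x) y = of_real (cmod (cinner (D x) y))"
    using exists_phase by blast
  have "D (u *\<^sub>C x) \<bullet> y = cmod (cinner (D x) y)"
    using u by (simp add: Re_cinner[symmetric] self_adjoint_scaleC[OF sa] cinner_scaleC_left)
  moreover have "D (u *\<^sub>C x) \<bullet> (u *\<^sub>C x) = D x \<bullet> x"
  proof -
    have "u * cnj u = 1" "cnj u * u = 1" using u(1) by (simp_all add: mult_cnj_self)
    then have "cinner (u *\<^sub>C D x) (u *\<^sub>C x) = cinner (D x) x"
      by (simp add: cinner_scaleC_left cinner_scaleC_right mult.assoc[symmetric])
    then show ?thesis
      by (simp add: Re_cinner[symmetric] self_adjoint_scaleC[OF sa])
  qed
  ultimately show ?thesis using real[of "u *\<^sub>C x"] by simp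
qed

lemma positive_eq_zero:
  assumes "positive D" "D x \<bullet> x \<le> 0" shows "D x = 0"
proof -
  have "(cmod (cinner (D x) (D x)))\<^sup>2 \<le> (D x \<bullet> x) * (D (D x) \<bullet> D x)"
    by (rule positive_Cauchy_Schwarz[OF assms(1)])
  moreover have "D x \<bullet> x = 0" using assms by (simp add: positive_def order_antisym)
  ultimately show ?thesis by (simp add: cinner_self)
qed

lemma positive_id: "positive (id :: 'a::chilbert_space \<Rightarrow> 'a)"
  using self_adjoint_scalar[of 1] by (simp add: positive_def id_def)

lemma cinner_Cauchy_Schwarz: "cmod (cinner x y) \<le> norm x * norm (y::'a::chilbert_space)"
proof -
  have "(cmod (cinner x y))\<^sup>2 \<le> (norm x * norm y)\<^sup>2"
    using positive_Cauchy_Schwarz[OF positive_id, of x y]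
    by (simp add: power2_norm_eq_inner power_mult_distrib)
  then show ?thesis by (rule power2_le_imp_le) simp
qed

lemma norm_diff_projection:
  assumes "norm (q::'a::chilbert_space) = 1"
  shows "(norm (x - cinner x q *\<^sub>C q))\<^sup>2 = (norm x)\<^sup>2 - (cmod (cinner x q))\<^sup>2"
proof -
  have "complex_of_real ((norm (x - cinner x q *\<^sub>C q))\<^sup>2) =
      of_real ((norm x)\<^sup>2) - cinner x q * cnj (cinner x q)"
    unfolding cinner_self[symmetric] cinner_algebra cinner_self_unit[OF assms]
    using cinner_commute[of q x] by simp
  also have "\<dots> = of_real ((norm x)\<^sup>2 - (cmod (cinner x q))\<^sup>2)"
    by (simp add: mult_cnj_self)
  finally show ?thesis by (simp only: of_real_eq_iff)
qed

lemma cinner_Cauchy_Schwarz_eq: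
  assumes "norm (q::'a::chilbert_space) = 1" "norm x \<le> cmod (cinner x q)"
  shows "x = cinner x q *\<^sub>C q"
proof -
  have "(norm x)\<^sup>2 \<le> (cmod (cinner x q))\<^sup>2" using assms(2) by (rule power_mono) simp
  then have "(norm (x - cinner x q *\<^sub>C q))\<^sup>2 \<le> 0"
    by (simp add: norm_diff_projection[OF assms(1)])
  then show ?thesis by simp
qed

section \<open>Rank-one operators and chains of effects\<close>

definition dyad :: "real \<Rightarrow> 'a::chilbert_space \<Rightarrow> 'a \<Rightarrow> 'a" where
  "dyad t q x = t *\<^sub>R (cinner x q *\<^sub>C q)"

lemma dyad_inner: "dyad t q x \<bullet> x = t * (cmod (cinner x q))\<^sup>2"
proof -
  have "Re (cinner x q * cinner q x) = (cmod (cinner x q))\<^sup>2"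
    by (metis Re_complex_of_real cinner_commute complex_norm_square)
  then show ?thesis
    by (simp add: dyad_def Re_cinner[symmetric] cinner_scaleR_left cinner_scaleC_left)
qed

lemma self_adjoint_dyad: "self_adjoint (dyad t q)"
proof (rule self_adjointI)
  show "bounded_linear (dyad t q)"
  proof (rule bounded_linear_intro)
    fix x y :: 'a and r :: real
    show "dyad t q (x + y) = dyad t q x + dyad t q y"
      by (simp add: dyad_def cinner_add_left complex_vector.scale_left_distrib scaleR_right_distrib)
    show "dyad t q (r *\<^sub>R x) = r *\<^sub>R dyad t q x"
      by (simp add: dyad_def cinner_scaleR_left scaleC_of_real_mult scaleR_left_commute)
    show "norm (dyad t q x) \<le> norm x * (\<bar>t\<bar> * norm q * norm q)"
      using mult_left_mono[OF cinner_Cauchy_Schwarz[of x q], of "\<bar>t\<bar> * norm q"]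
      by (simp add: dyad_def norm_scaleC mult_ac)
  qed
  show "dyad t q (c *\<^sub>C x) = c *\<^sub>C dyad t q x" for c x
    by (simp add: dyad_def cinner_scaleC_left scaleC_scaleC scaleC_scaleR)
  show "dyad t q x \<bullet> y = x \<bullet> dyad t q y" for x y
  proof -
    have "cinner (dyad t q x) y = cinner x (dyad t q y)"
      using cinner_commute[of q y] by (simp add: dyad_def cinner_algebra)
    then show ?thesis by (simp add: Re_cinner[symmetric])
  qed
qed

lemma positive_dyad: "0 \<le> t \<Longrightarrow> positive (dyad t q)"
  by (simp add: positive_def self_adjoint_dyad dyad_inner)

lemma dyad_0 [simp]: "dyad 0 q = (\<lambda>_. 0)"
  by (simp add: dyad_def fun_eq_iff)

lemma dyad_apply_self: "norm q = 1 \<Longrightarrow> dyad t q q = t *\<^sub>R q"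
  using complex_vector.scale_one[of q] by (simp add: dyad_def cinner_self_unit)

lemma dyad_inner_self: "norm q = 1 \<Longrightarrow> dyad t q q \<bullet> q = t"
  by (simp add: dyad_inner cinner_self_unit)

lemma dyad_phase: "cmod c = 1 \<Longrightarrow> dyad t (c *\<^sub>C q) = dyad t q"
proof
  fix x assume "cmod c = 1"
  then have "cnj c * c = 1" by (metis complex_norm_square mult.commute of_real_1 power_one)
  then have "(cnj c * cinner x q) * c = cinner x q"
    by (simp only: mult.commute[of "cnj c"] mult.assoc) simp
  then show "dyad t (c *\<^sub>C q) x = dyad t q x"
    by (simp add: dyad_def cinner_scaleC_right scaleC_scaleC)
qed

lemma dyad_le_dyad: "s \<le> t \<Longrightarrow> dyad s q \<preceq> dyad t q"
  by (simp add: op_le_iff dyad_inner mult_right_mono)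

text \<open>This replaces the square root of \<open>D\<close>: Cauchy--Schwarz exhibits below every positive operator
  a rank-one operator that has the same quadratic form at a prescribed vector.\<close>

lemma dyad_below_positive:
  assumes D: "positive D" and y: "0 < D y \<bullet> y"
  shows "dyad (1 / (D y \<bullet> y)) (D y) \<preceq> D"
proof -
  have "(cmod (cinner x (D y)))\<^sup>2 / (D y \<bullet> y) \<le> D x \<bullet> x" for x
    using positive_Cauchy_Schwarz[OF D, of x y] y
    by (simp add: self_adjoint_cinner[OF positive_self_adjoint[OF D]] field_simps)
  then show ?thesis by (simp add: op_le_iff dyad_inner)
qed

lemma dyad_normalize:
  assumes "v \<noteq> 0" shows "dyad t v = dyad (t * (norm v)\<^sup>2) (v /\<^sub>R norm v)"
  using assms by (simp add: dyad_def fun_eq_iff cinner_scaleR_right scaleC_scaleR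
    scaleC_of_real_mult power2_eq_square field_simps)
    (simp add: scaleC_of_real_mult[symmetric] field_simps)

text \<open>The rank-one operator of \<open>dyad_below_positive\<close> at \<open>y\<close> transfers the value of the form of \<open>A\<close> at
  \<open>y\<close> to the form of \<open>B\<close>.\<close>

lemma op_le_by_dyads:
  assumes A: "positive A" and B: "positive B"
    and below: "\<And>t q. norm q = 1 \<Longrightarrow> 0 < t \<Longrightarrow> dyad t q \<preceq> A \<Longrightarrow> dyad t q \<preceq> B"
  shows "A \<preceq> B"
  unfolding op_le_iff
proof
  fix y
  show "A y \<bullet> y \<le> B y \<bullet> y"
  proof (cases "0 < A y \<bullet> y")
    case True
    define t where "t = 1 / (A y \<bullet> y) * (norm (A y))\<^sup>2"
    define q where "q = A y /\<^sub>R norm (A y)"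
    have "A y \<noteq> 0" using True by auto
    then have "norm q = 1" "0 < t" using True by (auto simp: q_def t_def)
    moreover have eq: "dyad (1 / (A y \<bullet> y)) (A y) = dyad t q"
      unfolding t_def q_def by (rule dyad_normalize[OF \<open>A y \<noteq> 0\<close>])
    ultimately have "dyad (1 / (A y \<bullet> y)) (A y) \<preceq> B"
      using below dyad_below_positive[OF A True] by metis
    then have "1 / (A y \<bullet> y) * (cmod (cinner y (A y)))\<^sup>2 \<le> B y \<bullet> y"
      by (simp add: op_le_iff dyad_inner)
    moreover have "cmod (cinner y (A y)) = A y \<bullet> y"
      using self_adjoint_cinner_self[OF positive_self_adjoint[OF A], of y] True
      by (metis abs_of_pos cmod_cinner_commute norm_of_real)
    ultimately show ?thesis using True by (simp add: power2_eq_square)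
  next
    case False
    then show ?thesis using B by (meson positive_def linorder_not_less order_trans)
  qed
qed

text \<open>Cauchy--Schwarz for the form of \<open>A\<close> gives \<open>\<bar><x, q>\<bar>\<^sup>2 \<le> <A x, x> <q, w>\<close> with equality at
  \<open>x = w\<close>.  When \<open>A\<close> is invertible, \<open><q, w>\<close> is \<open><A\<inverse>q, q>\<close>.\<close>

lemma dyad_le_iff_preimage:
  assumes A: "positive A" and w: "A w = q" and "0 < q \<bullet> w" "0 \<le> t"
  shows "dyad t q \<preceq> A \<longleftrightarrow> t * (q \<bullet> w) \<le> 1"
proof
  have r: "cinner w q = of_real (q \<bullet> w)"
    using self_adjoint_cinner_self[OF positive_self_adjoint[OF A], of w] w
    by (metis cinner_commute complex_cnj_complex_of_real)
  assume "dyad t q \<preceq> A"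
  then have "t * (cmod (cinner w q))\<^sup>2 \<le> A w \<bullet> w" by (simp add: op_le_iff dyad_inner)
  then have "(t * (q \<bullet> w)) * (q \<bullet> w) \<le> 1 * (q \<bullet> w)" using w r by (simp add: power2_eq_square mult_ac)
  then show "t * (q \<bullet> w) \<le> 1" using assms(3) by (simp only: mult_le_cancel_right_pos)
next
  assume le: "t * (q \<bullet> w) \<le> 1"
  have "t * (cmod (cinner x q))\<^sup>2 \<le> A x \<bullet> x" for x
  proof -
    have "t * (cmod (cinner x q))\<^sup>2 \<le> t * ((A x \<bullet> x) * (q \<bullet> w))"
      using positive_Cauchy_Schwarz[OF A, of x w] w assms(4)
      by (intro mult_left_mono) (simp_all add: self_adjoint_cinner[OF positive_self_adjoint[OF A]])
    also have "\<dots> = (t * (q \<bullet> w)) * (A x \<bullet> x)" by simp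
    also have "\<dots> \<le> 1 * (A x \<bullet> x)"
      using le A by (intro mult_right_mono) (simp_all add: positive_def)
    finally show ?thesis by simp
  qed
  then show "dyad t q \<preceq> A" by (simp add: op_le_iff dyad_inner)
qed

text \<open>A positive operator below \<open>s|q><q|\<close> kills the orthogonal complement of \<open>q\<close>, hence also maps
  into the line of \<open>q\<close>.\<close>

lemma positive_le_dyad:
  assumes D: "positive D" and q: "norm q = 1" and le: "D \<preceq> dyad s q"
  shows "\<exists>b. 0 \<le> b \<and> b \<le> s \<and> D = dyad b q"
proof -
  note sa = positive_self_adjoint[OF D]
  define b where "b = D q \<bullet> q"
  have perp: "D z = 0" if "cinner z q = 0" for z
  proof (rule positive_eq_zero[OF D])
    have "D z \<bullet> z \<le> dyad s q z \<bullet> z" using le by (simp add: op_le_iff)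
    then show "D z \<bullet> z \<le> 0" using that by (simp add: dyad_inner)
  qed
  have split: "D z = cinner z q *\<^sub>C D q" for z
  proof -
    have "D (z - cinner z q *\<^sub>C q) = 0"
      by (rule perp) (simp add: cinner_algebra cinner_self_unit[OF q])
    then show ?thesis by (simp add: self_adjoint_diff[OF sa] self_adjoint_scaleC[OF sa])
  qed
  have "D q - b *\<^sub>R q = 0"
  proof -
    have bq: "cinner (D q) q = of_real b" unfolding b_def by (rule self_adjoint_cinner_self[OF sa])
    define v where "v = D q - b *\<^sub>R q"
    have v: "cinner v q = 0"
      by (simp add: v_def cinner_algebra cinner_self_unit[OF q] bq)
    have "cinner v v = cinner (D q) v - b * cinner q v"
      by (subst (1) v_def) (simp only: cinner_diff_left cinner_scaleR_left)
    also have "cinner q v = 0" using v by (metis cinner_commute complex_cnj_zero)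
    also have "cinner (D q) v = 0"
      using perp[OF v] by (simp add: self_adjoint_cinner[OF sa])
    finally show ?thesis by (simp add: cinner_self v_def)
  qed
  then have Dq: "D q = b *\<^sub>R q" by simp
  have "D = dyad b q"
    using split by (simp add: fun_eq_iff dyad_def Dq scaleC_scaleR)
  moreover have "0 \<le> b" using D by (simp add: b_def positive_def)
  moreover have "b \<le> s"
    using le dyad_inner_self[OF q] by (metis b_def op_le_iff)
  ultimately show ?thesis by blast
qed

lemma positive_range_line:
  assumes D: "positive D" and q: "norm q = 1" and range: "\<And>z. D z = cinner (D z) q *\<^sub>C q"
  shows "\<exists>s\<ge>0. D = dyad s q"
proof -
  note sa = positive_self_adjoint[OF D]
  define s where "s = D q \<bullet> q"
  have "cinner (D q) q *\<^sub>C q = s *\<^sub>R q"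
    by (simp add: self_adjoint_cinner_self[OF sa] s_def scaleC_of_real)
  then have Dq: "D q = s *\<^sub>R q" using range[of q] by (rule trans[rotated])
  have "cinner (D z) q *\<^sub>C q = dyad s q z" for z
    by (simp add: self_adjoint_cinner[OF sa, of z q] Dq cinner_scaleR_right
      dyad_def scaleC_of_real_mult)
  then have "D = dyad s q" by (intro ext trans[OF range])
  then show ?thesis using D by (auto simp: positive_def s_def)
qed

lemma dyad_le_dyad_imp_parallel:
  assumes "0 < s" "dyad s v \<preceq> dyad t w" "norm w = 1"
  shows "v = cinner v w *\<^sub>C w"
proof -
  define x where "x = v - cinner v w *\<^sub>C w"
  have xw: "cinner x w = 0" by (simp add: x_def cinner_algebra cinner_self_unit[OF assms(3)])
  have "dyad s v x \<bullet> x \<le> dyad t w x \<bullet> x" using assms(2) by (simp add: op_le_iff)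
  then have "s * (cmod (cinner x v))\<^sup>2 \<le> 0" by (simp add: dyad_inner xw)
  then have xv: "cinner x v = 0"
    using assms(1) by (simp add: mult_le_0_iff)
  have "cinner x x = cinner x v - cnj (cinner v w) * cinner x w"
    by (subst (2) x_def) (simp only: cinner_diff_right cinner_scaleC_right)
  then have "cinner x x = 0" by (simp only: xv xw) simp
  then have "x = 0" by (simp add: cinner_self)
  then show ?thesis by (simp add: x_def)
qed

lemma effects_iff: "A \<in> effects \<longleftrightarrow> positive A \<and> A \<preceq> id"
  by (auto simp: effects_def positive_def op_le_iff)

lemma effect_positive: "A \<in> effects \<Longrightarrow> positive A"
  by (simp add: effects_iff)

lemma effect_self_adjoint: "A \<in> effects \<Longrightarrow> self_adjoint A"
  by (simp add: effects_iff positive_def)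

lemma effects_antisym: "A \<in> effects \<Longrightarrow> B \<in> effects \<Longrightarrow> A \<preceq> B \<Longrightarrow> B \<preceq> A \<Longrightarrow> A = B"
  by (rule op_le_antisym) (auto dest: effect_self_adjoint)

lemma scalar_effect: "0 \<le> r \<Longrightarrow> r \<le> 1 \<Longrightarrow> (\<lambda>x. r *\<^sub>R x) \<in> effects"
  by (simp add: effects_iff positive_def self_adjoint_scalar op_le_iff mult_left_le_one_le)

lemma zero_effect: "(\<lambda>_. 0) \<in> effects"
  using scalar_effect[of 0] by simp

lemma dyad_le_scalar_iff:
  assumes "norm q = 1" "0 \<le> t" shows "dyad t q \<preceq> (\<lambda>x. r *\<^sub>R x) \<longleftrightarrow> t \<le> r"
proof
  assume "dyad t q \<preceq> (\<lambda>x. r *\<^sub>R x)"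
  then have "dyad t q q \<bullet> q \<le> (r *\<^sub>R q) \<bullet> q" by (simp add: op_le_iff)
  then show "t \<le> r"
    using assms by (simp add: dyad_inner_self power2_norm_eq_inner[symmetric])
next
  assume "t \<le> r"
  have "t * (cmod (cinner x q))\<^sup>2 \<le> r * (x \<bullet> x)" for x
  proof (rule mult_mono)
    show "(cmod (cinner x q))\<^sup>2 \<le> x \<bullet> x"
      using power_mono[OF cinner_Cauchy_Schwarz[of x q], of 2] assms(1)
      by (simp add: power2_norm_eq_inner)
  qed (use \<open>t \<le> r\<close> assms in auto)
  then show "dyad t q \<preceq> (\<lambda>x. r *\<^sub>R x)" by (simp add: op_le_iff dyad_inner)
qed

lemma dyad_effect_iff:
  assumes "norm q = 1" "0 \<le> t" shows "dyad t q \<in> effects \<longleftrightarrow> t \<le> 1"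
  using dyad_le_scalar_iff[OF assms, of 1] assms
  by (simp add: effects_iff positive_dyad id_def)

lemma effect_between:
  assumes "C \<in> effects" "A \<in> effects" "self_adjoint B" "C \<preceq> B" "B \<preceq> A"
  shows "B \<in> effects"
  using assms unfolding effects_iff positive_def op_le_iff by (meson order_trans)

definition order_chain :: "('a::chilbert_space \<Rightarrow> 'a) \<Rightarrow> ('a \<Rightarrow> 'a) \<Rightarrow> bool" where
  "order_chain C A \<longleftrightarrow> (\<forall>B\<in>effects. \<forall>E\<in>effects.
     C \<preceq> B \<and> B \<preceq> A \<and> C \<preceq> E \<and> E \<preceq> A \<longrightarrow> B \<preceq> E \<or> E \<preceq> B)"

text \<open>The operators \<open>C + |Dy><Dy| / <Dy, y>\<close>, where \<open>D = A - C\<close>, lie between \<open>C\<close> and \<open>A\<close>.  Two of them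
  are comparable only if their vectors are parallel, so in a chain the range of \<open>D\<close> is a
  line.\<close>

lemma order_chain_imp_dyad:
  assumes C: "C \<in> effects" and A: "A \<in> effects" and CA: "C \<preceq> A" and chain: "order_chain C A"
    and ex: "\<exists>e::'a::chilbert_space. norm e = 1"
  shows "\<exists>s (q::'a). norm q = 1 \<and> 0 \<le> s \<and> A = (\<lambda>x. C x + dyad s q x)"
proof -
  define D where "D = (\<lambda>x. A x - C x)"
  have saD: "self_adjoint D"
    unfolding D_def using A C by (intro self_adjoint_minus effect_self_adjoint)
  have D: "positive D"
    using CA saD by (simp add: positive_def D_def op_le_iff inner_diff_left)
  have par: "\<exists>c. D z = c *\<^sub>C D y" if y: "D y \<noteq> 0" for y z
  proof (cases "D z = 0")
    case True
    then show ?thesis by (intro exI[of _ 0]) simp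
  next
    case z: False
    define R where "R = (\<lambda>y. dyad (1 / (D y \<bullet> y)) (D y))"
    have pos: "0 < D x \<bullet> x" if "D x \<noteq> 0" for x
      using positive_eq_zero[OF D] that by (meson linorder_not_less)
    have mem: "(\<lambda>x. C x + R y x) \<in> effects" "C \<preceq> (\<lambda>x. C x + R y x)" "(\<lambda>x. C x + R y x) \<preceq> A"
      if "D y \<noteq> 0" for y
    proof -
      have le: "R y \<preceq> D" unfolding R_def by (rule dyad_below_positive[OF D pos[OF that]])
      have sa: "self_adjoint (\<lambda>x. C x + R y x)"
        using C unfolding R_def
        by (intro self_adjoint_plus self_adjoint_dyad effect_self_adjoint)
      show 1: "C \<preceq> (\<lambda>x. C x + R y x)"
        using pos[OF that] by (simp add: op_le_iff R_def inner_add_left dyad_inner)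
      show 2: "(\<lambda>x. C x + R y x) \<preceq> A"
        using le by (auto simp: op_le_iff D_def inner_add_left inner_diff_left le_diff_eq add.commute)
      show "(\<lambda>x. C x + R y x) \<in> effects" by (rule effect_between[OF C A sa 1 2])
    qed
    have "R y \<preceq> R z \<or> R z \<preceq> R y"
      using chain mem[OF y] mem[OF z] unfolding order_chain_def
      by (fastforce simp: op_le_iff inner_add_left)
    moreover have "\<exists>c. D u = c *\<^sub>C D v" if "R u \<preceq> R v" "D u \<noteq> 0" "D v \<noteq> 0" for u v
    proof -
      have "D u = cinner (D u) (D v /\<^sub>R norm (D v)) *\<^sub>C (D v /\<^sub>R norm (D v))"
      proof (rule dyad_le_dyad_imp_parallel)
        show "0 < 1 / (D u \<bullet> u)" using pos[OF that(2)] by simp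
        show "dyad (1 / (D u \<bullet> u)) (D u) \<preceq>
            dyad (1 / (D v \<bullet> v) * (norm (D v))\<^sup>2) (D v /\<^sub>R norm (D v))"
          using that(1) by (simp only: R_def dyad_normalize[OF that(3), symmetric])
        show "norm (D v /\<^sub>R norm (D v)) = 1" using that(3) by simp
      qed
      then show ?thesis by (metis scaleC_scaleC scaleC_of_real)
    qed
    ultimately consider c where "D y = c *\<^sub>C D z" | c where "D z = c *\<^sub>C D y"
      using y z by blast
    then show ?thesis
    proof cases
      case 1
      then have "c \<noteq> 0" using y by auto
      then have "D z = (1 / c) *\<^sub>C D y"
        using complex_vector.scale_one[of "D z"] by (simp add: 1 scaleC_scaleC)
      then show ?thesis by blast
    qed blast
  qed
  have "\<exists>s (q::'a). norm q = 1 \<and> 0 \<le> s \<and> D = dyad s q"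
  proof (cases "\<exists>y. D y \<noteq> 0")
    case True
    then obtain y where y: "D y \<noteq> 0" by blast
    define q where "q = D y /\<^sub>R norm (D y)"
    have q: "norm q = 1" using y by (simp add: q_def)
    have "D z = cinner (D z) q *\<^sub>C q" for z
    proof -
      obtain c where "D z = c *\<^sub>C D y" using par[OF y] by blast
      also have "D y = norm (D y) *\<^sub>R q" using y by (simp add: q_def)
      finally have "D z = (norm (D y) * c) *\<^sub>C q"
        by (simp only: scaleC_of_real_mult scaleC_scaleR)
      then show ?thesis by (simp add: cinner_scaleC_left cinner_self_unit[OF q])
    qed
    then show ?thesis using positive_range_line[OF D q] q by blast
  next
    case False
    then have "D = dyad 0 q" for q by auto
    then show ?thesis using ex by blast
  qed
  then show ?thesis by (auto simp: D_def fun_eq_iff algebra_simps)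
qed

text \<open>The effects in this interval are \<open>C + b|q><q|\<close> with real \<open>b\<close>, by \<open>positive_le_dyad\<close>.\<close>

lemma order_chain_dyad:
  assumes C: "C \<in> effects" and q: "norm q = 1"
  shows "order_chain C (\<lambda>x. C x + dyad s q x)"
proof -
  have step: "\<exists>b. B = (\<lambda>x. C x + dyad b q x)"
    if B: "B \<in> effects" "C \<preceq> B" "B \<preceq> (\<lambda>x. C x + dyad s q x)" for B
  proof -
    have "positive (\<lambda>x. B x - C x)"
      using B(2) self_adjoint_minus[OF effect_self_adjoint[OF B(1)] effect_self_adjoint[OF C]]
      by (simp add: positive_def op_le_iff inner_diff_left)
    moreover have "(\<lambda>x. B x - C x) \<preceq> dyad s q"
      using B(3) by (simp add: op_le_iff inner_diff_left inner_add_left diff_le_eq add.commute)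
    ultimately obtain b where "(\<lambda>x. B x - C x) = dyad b q" using positive_le_dyad q by blast
    then have "B = (\<lambda>x. C x + dyad b q x)" by (auto simp: fun_eq_iff algebra_simps)
    then show ?thesis by blast
  qed
  show ?thesis
    unfolding order_chain_def
  proof (intro ballI impI)
    fix B E :: "'a \<Rightarrow> 'a"
    assume "B \<in> effects" "E \<in> effects" "C \<preceq> B \<and> B \<preceq> (\<lambda>x. C x + dyad s q x) \<and>
      C \<preceq> E \<and> E \<preceq> (\<lambda>x. C x + dyad s q x)"
    then obtain b e where "B = (\<lambda>x. C x + dyad b q x)" "E = (\<lambda>x. C x + dyad e q x)"
      using step by metis
    moreover have "b \<le> e \<or> e \<le> b" by auto
    ultimately show "B \<preceq> E \<or> E \<preceq> B"
      using dyad_le_dyad[of b e q] dyad_le_dyad[of e b q]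
      by (auto simp: op_le_iff inner_add_left)
  qed
qed

section \<open>Action of an order automorphism on rank-one effects\<close>

text \<open>If \<open>|q><q| \<le> D\<close>, then the form of the positive operator \<open>I - D\<close> vanishes at \<open>q\<close>, hence
  \<open>I - D\<close> kills \<open>q\<close>.\<close>

lemma dyad_1_le_effect_iff:
  assumes D: "D \<in> effects" and q: "norm q = 1"
  shows "dyad 1 q \<preceq> D \<longleftrightarrow> D q = q"
proof
  assume le: "dyad 1 q \<preceq> D"
  have "positive (\<lambda>x. 1 *\<^sub>R x - D x)"
    using D self_adjoint_minus[OF self_adjoint_scalar[of 1] effect_self_adjoint[OF D]]
    by (simp add: positive_def effects_iff op_le_iff inner_diff_left)
  moreover have "(1 *\<^sub>R q - D q) \<bullet> q \<le> 0"
  proof -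
    have "dyad 1 q q \<bullet> q \<le> D q \<bullet> q" using le by (simp add: op_le_iff)
    then show ?thesis
      by (simp add: dyad_inner_self[OF q] inner_diff_left power2_norm_eq_inner[symmetric] q)
  qed
  ultimately have "1 *\<^sub>R q - D q = 0" by (rule positive_eq_zero)
  then show "D q = q" by simp
next
  assume "D q = q"
  then show "dyad 1 q \<preceq> D"
    using dyad_le_iff_preimage[OF effect_positive[OF D], of q q 1] q
    by (simp add: power2_norm_eq_inner[symmetric])
qed

lemma Bessel_two:
  assumes "norm p = 1" "norm r = 1" "cinner p r = 0"
  shows "(cmod (cinner x p))\<^sup>2 + (cmod (cinner x r))\<^sup>2 \<le> (norm (x::'a::chilbert_space))\<^sup>2"
proof -
  define y where "y = x - cinner x p *\<^sub>C p"
  have "cinner y r = cinner x r" using assms(3) by (simp add: y_def cinner_algebra)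
  then have "(cmod (cinner x r))\<^sup>2 \<le> (norm y)\<^sup>2"
    using cinner_Cauchy_Schwarz[of y r] assms(2) by (intro power_mono) simp_all
  then show ?thesis using norm_diff_projection[OF assms(1), of x] by (simp add: y_def)
qed

lemma dyad_plus_dyad_effect:
  assumes "norm p = 1" "norm r = 1" "cinner p r = 0"
  shows "(\<lambda>x. dyad 1 p x + dyad 1 r x) \<in> effects"
  using Bessel_two[OF assms]
  by (simp add: effects_iff positive_def op_le_iff self_adjoint_plus self_adjoint_dyad
      inner_add_left dyad_inner power2_norm_eq_inner)

lemma unit_splitting:
  fixes q e :: "'a::chilbert_space"
  assumes q: "norm q = 1" and e: "norm e = 1" and qe: "cinner q e = 0" and x: "0 \<le> x" "x \<le> 1"
  shows "\<exists>p r. norm p = 1 \<and> norm r = 1 \<and> cinner p r = 0 \<and> (cmod (cinner p q))\<^sup>2 = x \<and>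
    (cmod (cinner r q))\<^sup>2 = 1 - x \<and> (\<exists>a b. q = a *\<^sub>R p + b *\<^sub>R r)"
proof -
  define a b where "a = sqrt x" and "b = sqrt (1 - x)"
  have ab: "a * a = x" "b * b = 1 - x" using x by (simp_all add: a_def b_def)
  have ab1: "complex_of_real a * of_real a + of_real b * of_real b = 1"
    using ab by (metis add.commute diff_add_cancel of_real_1 of_real_add of_real_mult)
  have eq: "cinner e q = 0" using qe by (metis cinner_commute complex_cnj_zero)
  note [simp] = qe eq cinner_self_unit[OF q] cinner_self_unit[OF e]
  define p r where "p = a *\<^sub>R q + b *\<^sub>R e" and "r = b *\<^sub>R q - a *\<^sub>R e"
  have "cinner p p = 1" "cinner r r = 1"
    using ab1 by (simp_all add: p_def r_def cinner_algebra add.commute)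
  then have "complex_of_real ((norm p)\<^sup>2) = 1" "complex_of_real ((norm r)\<^sup>2) = 1"
    by (simp_all only: cinner_self)
  then have "norm p = 1" "norm r = 1"
    by (simp_all only: of_real_eq_1_iff power2_eq_1_iff) (smt (verit) norm_ge_zero)+
  moreover have "cinner p r = 0" by (simp add: p_def r_def cinner_algebra)
  moreover have "(cmod (cinner p q))\<^sup>2 = x" "(cmod (cinner r q))\<^sup>2 = 1 - x"
    using ab by (simp_all add: p_def r_def cinner_algebra power2_eq_square)
  moreover have "q = a *\<^sub>R p + b *\<^sub>R r"
  proof -
    have "a *\<^sub>R p + b *\<^sub>R r = (a * a + b * b) *\<^sub>R q"
      by (simp add: p_def r_def algebra_simps)
    then show ?thesis by (simp add: ab)
  qed
  ultimately show ?thesis by blast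
qed

locale order_automorphism =
  fixes \<phi> :: "('a::chilbert_space \<Rightarrow> 'a) \<Rightarrow> ('a \<Rightarrow> 'a)"
  assumes bij: "bij_betw \<phi> effects effects"
    and order: "\<And>A B. A \<in> effects \<Longrightarrow> B \<in> effects \<Longrightarrow> A \<preceq> B \<longleftrightarrow> \<phi> A \<preceq> \<phi> B"
begin

lemma effect: "A \<in> effects \<Longrightarrow> \<phi> A \<in> effects"
  using bij by (rule bij_betwE[THEN bspec])

lemma onto: "B \<in> effects \<Longrightarrow> \<exists>A\<in>effects. \<phi> A = B"
proof -
  assume "B \<in> effects"
  then have "B \<in> \<phi> ` effects" by (simp only: bij_betw_imp_surj_on[OF bij])
  then show ?thesis by blast
qed

lemma image_zero: "\<phi> (\<lambda>_. 0) = (\<lambda>_. 0)"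
proof -
  obtain A where A: "A \<in> effects" "\<phi> A = (\<lambda>_. 0)" using onto[OF zero_effect] by blast
  have "(\<lambda>_. 0) \<preceq> A" using A(1) by (simp add: effects_def)
  then have "\<phi> (\<lambda>_. 0) \<preceq> (\<lambda>_. 0)" using order[OF zero_effect A(1)] A(2) by simp
  moreover have "(\<lambda>_. 0) \<preceq> \<phi> (\<lambda>_. 0)" using effect[OF zero_effect] by (simp add: effects_def)
  ultimately show ?thesis using effects_antisym effect zero_effect by blast
qed

lemma order_chain_image:
  assumes C: "C \<in> effects" and A: "A \<in> effects" and chain: "order_chain C A"
  shows "order_chain (\<phi> C) (\<phi> A)"
  unfolding order_chain_def
proof (intro ballI impI)
  fix B E assume "B \<in> effects" "E \<in> effects"
    and le: "\<phi> C \<preceq> B \<and> B \<preceq> \<phi> A \<and> \<phi> C \<preceq> E \<and> E \<preceq> \<phi> A"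
  then obtain B' E' where BE: "B' \<in> effects" "\<phi> B' = B" "E' \<in> effects" "\<phi> E' = E"
    using onto by metis
  then have "B' \<preceq> E' \<or> E' \<preceq> B'"
    using chain le order C A unfolding order_chain_def by blast
  then show "B \<preceq> E \<or> E \<preceq> B" using order BE by blast
qed

lemma image_add_dyad:
  assumes C: "C \<in> effects" and A: "(\<lambda>x. C x + dyad s q x) \<in> effects" and q: "norm q = 1" and "0 \<le> s"
  shows "\<exists>s' q'. norm q' = 1 \<and> 0 \<le> s' \<and> \<phi> (\<lambda>x. C x + dyad s q x) = (\<lambda>x. \<phi> C x + dyad s' q' x)"
proof (rule order_chain_imp_dyad)
  show "\<phi> C \<in> effects" "\<phi> (\<lambda>x. C x + dyad s q x) \<in> effects" using C A by (auto intro: effect)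
  have "C \<preceq> (\<lambda>x. C x + dyad s q x)"
    using \<open>0 \<le> s\<close> by (simp add: op_le_iff inner_add_left dyad_inner)
  then show "\<phi> C \<preceq> \<phi> (\<lambda>x. C x + dyad s q x)" using order[OF C A] by blast
  show "order_chain (\<phi> C) (\<phi> (\<lambda>x. C x + dyad s q x))"
    by (rule order_chain_image[OF C A order_chain_dyad[OF C q]])
  show "\<exists>e::'a. norm e = 1" using q by blast
qed

lemma image_dyad:
  assumes "norm q = 1" "0 \<le> t" "t \<le> 1"
  shows "\<exists>s r. norm r = 1 \<and> 0 \<le> s \<and> s \<le> 1 \<and> \<phi> (dyad t q) = dyad s r"
proof -
  have e: "dyad t q \<in> effects" using assms by (simp add: dyad_effect_iff)
  then obtain s r where sr: "norm r = 1" "0 \<le> s" "\<phi> (dyad t q) = dyad s r"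
    using image_add_dyad[OF zero_effect, of t q] assms by (auto simp: image_zero)
  then have "s \<le> 1" using effect[OF e] dyad_effect_iff by metis
  then show ?thesis using sr by blast
qed

lemma inverse_automorphism: "order_automorphism (inv_into effects \<phi>)"
proof
  show "bij_betw (inv_into effects \<phi>) effects effects" by (rule bij_betw_inv_into[OF bij])
  fix A B :: "'a \<Rightarrow> 'a" assume "A \<in> effects" "B \<in> effects"
  then obtain A' B' where "A' \<in> effects" "B' \<in> effects" "\<phi> A' = A" "\<phi> B' = B"
    using onto by blast
  then show "A \<preceq> B \<longleftrightarrow> inv_into effects \<phi> A \<preceq> inv_into effects \<phi> B"
    using order[of A' B'] bij_betw_inv_into_left[OF bij] by auto
qed

lemma onto_dyad:
  assumes "norm q = 1" "0 \<le> t" "t \<le> 1"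
  shows "\<exists>s r. norm r = 1 \<and> 0 \<le> s \<and> s \<le> 1 \<and> \<phi> (dyad s r) = dyad t q"
proof -
  obtain s r where sr: "norm r = 1" "0 \<le> s" "s \<le> 1"
    and inv: "inv_into effects \<phi> (dyad t q) = dyad s r"
    using order_automorphism.image_dyad[OF inverse_automorphism assms] by (elim exE conjE) (rule that)
  have "dyad t q \<in> effects" using assms by (simp add: dyad_effect_iff)
  then have "\<phi> (dyad s r) = dyad t q"
    unfolding inv[symmetric] by (rule bij_betw_inv_into_right[OF bij])
  then show ?thesis using sr by blast
qed

text \<open>The projections are the maximal elements among the rank-one effects.\<close>

lemma exists_image_unit:
  assumes q: "norm q = 1"
  shows "\<exists>r. norm r = 1 \<and> \<phi> (dyad 1 q) = dyad 1 r"
proof -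
  obtain s r where sr: "norm r = 1" "0 \<le> s" "s \<le> 1" "\<phi> (dyad 1 q) = dyad s r"
    using image_dyad[OF q zero_le_one order_refl] by (elim exE conjE) (rule that)
  obtain t p where tp: "norm p = 1" "0 \<le> t" "t \<le> 1" "\<phi> (dyad t p) = dyad 1 r"
    using onto_dyad[OF sr(1) zero_le_one order_refl] by (elim exE conjE) (rule that)
  have e: "dyad 1 q \<in> effects" "dyad t p \<in> effects" using q tp by (simp_all add: dyad_effect_iff)
  have "\<phi> (dyad 1 q) \<preceq> \<phi> (dyad t p)" using sr tp by (simp add: dyad_le_dyad)
  then have le: "dyad 1 q \<preceq> dyad t p" using order e by blast
  then obtain b where b: "b \<le> t" "dyad 1 q = dyad b p"
    using positive_le_dyad[OF positive_dyad tp(1)] by (metis zero_le_one)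
  have "dyad b p q \<bullet> q = 1" using dyad_inner_self[OF q, of 1] b(2) by simp
  moreover have "(cmod (cinner q p))\<^sup>2 \<le> 1"
    using cinner_Cauchy_Schwarz[of q p] q tp(1) by (simp add: power_le_one)
  moreover have "0 \<le> b" using b(2) dyad_inner_self[OF tp(1), of b] positive_dyad[of 1 q]
    by (metis positive_def zero_le_one)
  ultimately have "1 \<le> b"
    using mult_left_mono[of "(cmod (cinner q p))\<^sup>2" 1 b] by (simp add: dyad_inner)
  then have "t = b" using b tp by simp
  then show ?thesis using b tp sr by metis
qed

text \<open>A representative of the image line; its phase is arbitrary.\<close>

definition image_unit :: "'a \<Rightarrow> 'a" where
  "image_unit q = (SOME r. norm r = 1 \<and> \<phi> (dyad 1 q) = dyad 1 r)"

lemma image_unit: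
  assumes "norm q = 1"
  shows "norm (image_unit q) = 1" "\<phi> (dyad 1 q) = dyad 1 (image_unit q)"
  using someI_ex[OF exists_image_unit[OF assms]] by (auto simp: image_unit_def)

lemma image_dyad_line:
  assumes q: "norm q = 1" and t: "0 \<le> t" "t \<le> 1"
  shows "\<exists>b. 0 \<le> b \<and> b \<le> 1 \<and> \<phi> (dyad t q) = dyad b (image_unit q)"
proof (rule positive_le_dyad)
  have e: "dyad t q \<in> effects" "dyad 1 q \<in> effects" using q t by (simp_all add: dyad_effect_iff)
  show "positive (\<phi> (dyad t q))" using e effect effect_positive by blast
  show "\<phi> (dyad t q) \<preceq> dyad 1 (image_unit q)"
    using order[OF e] dyad_le_dyad[OF t(2)] image_unit[OF q] by metis
qed (rule image_unit(1)[OF q])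

lemma onto_dyad_line:
  assumes q: "norm q = 1" and b: "0 \<le> b" "b \<le> 1"
  shows "\<exists>t. 0 \<le> t \<and> t \<le> 1 \<and> \<phi> (dyad t q) = dyad b (image_unit q)"
proof -
  have e: "dyad b (image_unit q) \<in> effects" "dyad 1 q \<in> effects"
    using q b image_unit by (simp_all add: dyad_effect_iff)
  obtain A where A: "A \<in> effects" "\<phi> A = dyad b (image_unit q)" using onto[OF e(1)] by blast
  have "A \<preceq> dyad 1 q"
    using order[OF A(1) e(2)] dyad_le_dyad[OF b(2)] image_unit[OF q] A(2) by metis
  then show ?thesis using positive_le_dyad[OF effect_positive[OF A(1)] q] A(2) by metis
qed

text \<open>Membership of a vector in the span of an orthonormal pair is visible in the order: an effect
  above the two projections fixes both vectors, hence their span.\<close>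

lemma image_unit_Parseval:
  assumes unit: "norm q = 1" "norm p = 1" "norm r = 1"
    and orth: "cinner (image_unit p) (image_unit r) = 0" and span: "q = a *\<^sub>R p + b *\<^sub>R r"
  shows "(cmod (cinner (image_unit q) (image_unit p)))\<^sup>2 +
    (cmod (cinner (image_unit q) (image_unit r)))\<^sup>2 = 1"
proof -
  define E where "E = (\<lambda>x. dyad 1 (image_unit p) x + dyad 1 (image_unit r) x)"
  have E: "E \<in> effects"
    unfolding E_def using unit orth by (intro dyad_plus_dyad_effect image_unit)
  obtain D where D: "D \<in> effects" "\<phi> D = E" using onto[OF E] by blast
  have e: "dyad 1 u \<in> effects" if "norm u = 1" for u :: 'a using that by (simp add: dyad_effect_iff)
  have le: "dyad 1 u \<preceq> D \<longleftrightarrow> dyad 1 (image_unit u) \<preceq> E" if "norm u = 1" for u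
    using order[OF e[OF that] D(1)] image_unit[OF that] D(2) by simp
  have "dyad 1 (image_unit p) \<preceq> E" "dyad 1 (image_unit r) \<preceq> E"
    by (simp_all add: op_le_iff E_def inner_add_left dyad_inner)
  then have "D p = p" "D r = r" using le dyad_1_le_effect_iff[OF D(1)] unit by blast+
  then have "D q = q"
    using effect_self_adjoint[OF D(1)] by (simp add: span self_adjoint_add self_adjoint_scaleR)
  then have "dyad 1 (image_unit q) \<preceq> E" using le dyad_1_le_effect_iff[OF D(1)] unit by blast
  then have "dyad 1 (image_unit q) (image_unit q) \<bullet> image_unit q \<le> E (image_unit q) \<bullet> image_unit q"
    by (simp add: op_le_iff)
  then have "1 \<le> (cmod (cinner (image_unit q) (image_unit p)))\<^sup>2 +
      (cmod (cinner (image_unit q) (image_unit r)))\<^sup>2"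
    by (simp add: E_def inner_add_left dyad_inner dyad_inner_self image_unit(1)[OF unit(1)])
       (simp add: cinner_self_unit image_unit(1)[OF unit(1)])
  moreover have "\<dots> \<le> 1"
    using Bessel_two[OF image_unit(1)[OF unit(2)] image_unit(1)[OF unit(3)] orth, of "image_unit q"]
    by (simp add: image_unit(1)[OF unit(1)])
  ultimately show ?thesis by simp
qed

end

section \<open>Transition probabilities\<close>

text \<open>A coordinate in \<open>[0, 1]\<close> for the weights in \<open>[l, 1]\<close>, affine in the inverse weight:
  \<open>1 / weight l x = (1 - (1 - l) x) / l\<close>.\<close>

definition weight :: "real \<Rightarrow> real \<Rightarrow> real" where
  "weight l x = l / (1 - (1 - l) * x)"

lemma weight_denominator:
  assumes "0 < l" "l < 1" "x \<le> 1" shows "0 < 1 - (1 - l) * (x::real)"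
proof -
  have "(1 - l) * x \<le> (1 - l) * 1" using assms by (intro mult_left_mono) simp_all
  also have "\<dots> < 1" using assms by simp
  finally show ?thesis by simp
qed

lemma weight_1 [simp]: "0 < l \<Longrightarrow> weight l 1 = 1"
  by (simp add: weight_def)

lemma weight_0 [simp]: "weight l 0 = l"
  by (simp add: weight_def)

lemma weight_le_iff:
  assumes "0 < l" "l < 1" "x \<le> 1" "y \<le> 1" shows "weight l x \<le> weight l y \<longleftrightarrow> x \<le> y"
proof -
  have "l / a \<le> l / b \<longleftrightarrow> b \<le> a" if "0 < a" "0 < b" for a b :: real
    using that \<open>0 < l\<close> by (simp add: field_simps)
  then have "weight l x \<le> weight l y \<longleftrightarrow> (1 - l) * x \<le> (1 - l) * y"
    using weight_denominator[OF assms(1,2,3)] weight_denominator[OF assms(1,2,4)]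
    by (simp add: weight_def)
  then show ?thesis using \<open>l < 1\<close> by simp
qed

lemma weight_onto:
  assumes "0 < l" "l < 1" "l \<le> t" "t \<le> 1" shows "\<exists>x\<in>{0..1}. weight l x = t"
proof
  show "(1 - l / t) / (1 - l) \<in> {0..1}" using assms by (simp add: field_simps)
  show "weight l ((1 - l / t) / (1 - l)) = t" using assms by (simp add: weight_def)
qed

definition scalar_plus_dyad :: "real \<Rightarrow> real \<Rightarrow> 'a::chilbert_space \<Rightarrow> 'a \<Rightarrow> 'a" where
  "scalar_plus_dyad l y p x = l *\<^sub>R x + dyad (weight l y - l) p x"

lemma scalar_plus_dyad_effect:
  assumes l: "0 < l" "l < 1" and y: "0 \<le> y" "y \<le> 1" and p: "norm p = 1"
  shows "scalar_plus_dyad l y p \<in> effects"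
proof -
  define w where "w = weight l y - l"
  have w: "0 \<le> w" "w \<le> 1 - l"
    using weight_le_iff[OF l, of 0 y] weight_le_iff[OF l, of y 1] l y by (simp_all add: w_def)
  have "self_adjoint (scalar_plus_dyad l y p)"
    unfolding scalar_plus_dyad_def[abs_def]
    by (intro self_adjoint_plus self_adjoint_scalar self_adjoint_dyad)
  moreover have "0 \<le> scalar_plus_dyad l y p x \<bullet> x" "scalar_plus_dyad l y p x \<bullet> x \<le> x \<bullet> x" for x
  proof -
    have "dyad w p \<preceq> (\<lambda>x. (1 - l) *\<^sub>R x)" using dyad_le_scalar_iff[OF p w(1)] w(2) by blast
    then have "dyad w p x \<bullet> x \<le> (1 - l) * (x \<bullet> x)" by (simp add: op_le_iff)
    then show "scalar_plus_dyad l y p x \<bullet> x \<le> x \<bullet> x"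
      by (simp add: scalar_plus_dyad_def w_def inner_add_left algebra_simps)
    show "0 \<le> scalar_plus_dyad l y p x \<bullet> x"
      using l w by (simp add: scalar_plus_dyad_def w_def[symmetric] inner_add_left dyad_inner)
  qed
  ultimately show ?thesis by (simp add: effects_iff positive_def op_le_iff)
qed

text \<open>The scale \<open>weight l\<close> of \<open>[l, 1]\<close> is chosen to make this comparison linear: the inverse of
  \<open>scalar_plus_dyad l y p\<close> is \<open>(1 - (1 - l) y |p><p|) / l\<close>.\<close>

lemma dyad_le_scalar_plus_dyad_iff:
  assumes l: "0 < l" "l < 1" and x: "0 \<le> x" "x \<le> 1" and y: "0 \<le> y" "y \<le> 1"
    and p: "norm p = 1" and q: "norm (q::'a::chilbert_space) = 1"
  shows "dyad (weight l x) q \<preceq> scalar_plus_dyad l y p \<longleftrightarrow> x \<le> (cmod (cinner p q))\<^sup>2 * y"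
proof -
  define c where "c = (cmod (cinner p q))\<^sup>2"
  have c: "c \<le> 1" "0 \<le> c"
    unfolding c_def using cinner_Cauchy_Schwarz[of p q] p q by (simp_all add: power_le_one)
  have cy: "c * y \<le> 1" "0 \<le> c * y" using c y by (simp_all add: mult_le_one)
  \<comment> \<open>the preimage of \<open>q\<close> under \<open>scalar_plus_dyad l y p\<close>\<close>
  define w where "w = (1 / l) *\<^sub>R (q - ((1 - l) * y) *\<^sub>R (cinner q p *\<^sub>C p))"
  have cp: "cinner (cinner q p *\<^sub>C p) p = cinner q p"
    by (simp add: cinner_scaleC_left cinner_self_unit[OF p])
  have wp: "cinner w p = of_real ((1 - (1 - l) * y) / l) * cinner q p"
    unfolding w_def cinner_scaleR_left cinner_diff_left cp
    using l by (simp add: field_simps)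
  have wq: "q \<bullet> w = (1 - (1 - l) * (c * y)) / l"
  proof -
    have "q \<bullet> (cinner q p *\<^sub>C p) = c"
      using dyad_inner[of 1 p q] by (simp add: dyad_def inner_commute c_def cmod_cinner_commute)
    then show ?thesis
      using q by (simp add: w_def inner_diff_right power2_norm_eq_inner[symmetric])
  qed
  have Aw: "scalar_plus_dyad l y p w = q"
  proof -
    define d where "d = 1 - (1 - l) * y"
    have d: "0 < d" unfolding d_def by (rule weight_denominator[OF l y(2)])
    have "scalar_plus_dyad l y p w =
      (q - ((1 - l) * y) *\<^sub>R (cinner q p *\<^sub>C p)) + ((l / d - l) * (d / l)) *\<^sub>R (cinner q p *\<^sub>C p)"
      using l d by (simp only: scalar_plus_dyad_def dyad_def wp weight_def d_def[symmetric]
        scaleC_of_real_mult) (simp add: w_def)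
    moreover have "(l / d - l) * (d / l) = (1 - l) * y"
      using l d by (simp add: field_simps) (simp add: d_def algebra_simps)
    ultimately show ?thesis by simp
  qed
  have wl: "0 \<le> weight l x" using weight_le_iff[OF l, of 0 x] l x by simp
  have "dyad (weight l x) q \<preceq> scalar_plus_dyad l y p \<longleftrightarrow> weight l x * (q \<bullet> w) \<le> 1"
  proof (rule dyad_le_iff_preimage[where A = "scalar_plus_dyad l y p" and w = w, OF _ Aw _ wl])
    show "positive (scalar_plus_dyad l y p)"
      using scalar_plus_dyad_effect[OF l y p] by (rule effect_positive)
    show "0 < q \<bullet> w" unfolding wq using weight_denominator[OF l cy(1)] l by simp
  qed
  also have "\<dots> \<longleftrightarrow> (1 - (1 - l) * (c * y)) / (1 - (1 - l) * x) \<le> 1"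
    unfolding wq weight_def using l by simp
  also have "\<dots> \<longleftrightarrow> (1 - l) * x \<le> (1 - l) * (c * y)"
    using weight_denominator[OF l x(2)] by (simp add: divide_le_eq_1)
  also have "\<dots> \<longleftrightarrow> x \<le> c * y" using l by simp
  finally show ?thesis by (simp add: c_def)
qed

locale scalar_fixing_automorphism = order_automorphism \<phi>
  for \<phi> :: "('a::chilbert_space \<Rightarrow> 'a) \<Rightarrow> ('a \<Rightarrow> 'a)" +
  fixes l :: real
  assumes l: "0 < l" "l < 1"
    and fixed: "\<phi> (\<lambda>x. l *\<^sub>R x) = (\<lambda>x. l *\<^sub>R x)"
    and two_dimensional: "\<And>q::'a. norm q = 1 \<Longrightarrow> \<exists>e. norm e = 1 \<and> cinner q e = 0"
begin

lemma fixed_scalar_effect: "(\<lambda>x. l *\<^sub>R x) \<in> effects"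
  using l by (intro scalar_effect) simp_all

lemma dyad_le_scalar_image_iff:
  assumes q: "norm q = 1" and t: "0 \<le> t" "t \<le> 1" and b: "0 \<le> b"
    and img: "\<phi> (dyad t q) = dyad b (image_unit q)"
  shows "b \<le> l \<longleftrightarrow> t \<le> l"
proof -
  have "dyad t q \<in> effects" using q t by (simp add: dyad_effect_iff)
  then have "dyad t q \<preceq> (\<lambda>x. l *\<^sub>R x) \<longleftrightarrow> dyad b (image_unit q) \<preceq> (\<lambda>x. l *\<^sub>R x)"
    using order[OF _ fixed_scalar_effect] img fixed by metis
  then show ?thesis by (simp add: dyad_le_scalar_iff q t(1) b image_unit(1))
qed

text \<open>The weight \<open>l\<close> is the largest one on its line below the fixed operator \<open>l I\<close>.\<close>

lemma image_dyad_l: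
  assumes q: "norm q = 1" shows "\<phi> (dyad l q) = dyad l (image_unit q)"
proof -
  obtain b where b: "0 \<le> b" "b \<le> 1" "\<phi> (dyad l q) = dyad b (image_unit q)"
    using image_dyad_line[OF q, of l] l by auto
  then have "b \<le> l" using dyad_le_scalar_image_iff[OF q _ _ b(1,3)] l by simp
  obtain t where t: "0 \<le> t" "t \<le> 1" "\<phi> (dyad t q) = dyad l (image_unit q)"
    using onto_dyad_line[OF q, of l] l by auto
  then have "t \<le> l" using dyad_le_scalar_image_iff[OF q t(1,2) _ t(3)] l by simp
  then have "dyad t q \<preceq> dyad l q" by (rule dyad_le_dyad)
  moreover have "dyad t q \<in> effects" "dyad l q \<in> effects" using q t l by (simp_all add: dyad_effect_iff)
  ultimately have "dyad l (image_unit q) \<preceq> dyad b (image_unit q)" using order t b by metis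
  moreover have "norm (image_unit q) = 1" by (rule image_unit[OF q])
  ultimately have "l \<le> b" using dyad_inner_self unfolding op_le_iff by metis
  then show ?thesis using b \<open>b \<le> l\<close> by simp
qed

lemma weight_bounds: "0 \<le> x \<Longrightarrow> x \<le> 1 \<Longrightarrow> l \<le> weight l x \<and> weight l x \<le> 1"
  using weight_le_iff[OF l, of 0 x] weight_le_iff[OF l, of x 1] l by simp

lemma dyad_weight_effect: "norm q = 1 \<Longrightarrow> 0 \<le> x \<Longrightarrow> x \<le> 1 \<Longrightarrow> dyad (weight l x) q \<in> effects"
  using weight_bounds[of x] l by (simp add: dyad_effect_iff)

lemma dyad_weight_le_iff:
  assumes "norm q = 1" "x \<le> 1" "y \<le> 1"
  shows "dyad (weight l x) q \<preceq> dyad (weight l y) q \<longleftrightarrow> x \<le> y"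
proof
  assume "dyad (weight l x) q \<preceq> dyad (weight l y) q"
  then have "weight l x \<le> weight l y" using dyad_inner_self[OF assms(1)] unfolding op_le_iff by metis
  then show "x \<le> y" using weight_le_iff[OF l] assms by simp
qed (use weight_le_iff[OF l] assms in \<open>simp add: dyad_le_dyad\<close>)

lemma image_dyad_weight:
  assumes q: "norm q = 1" and x: "0 \<le> x" "x \<le> 1"
  shows "\<exists>y. 0 \<le> y \<and> y \<le> 1 \<and> \<phi> (dyad (weight l x) q) = dyad (weight l y) (image_unit q)"
proof -
  obtain b where b: "0 \<le> b" "b \<le> 1" "\<phi> (dyad (weight l x) q) = dyad b (image_unit q)"
    using image_dyad_line[OF q, of "weight l x"] weight_bounds[OF x] l by auto
  have "dyad l q \<preceq> dyad (weight l x) q" using weight_bounds[OF x] by (simp add: dyad_le_dyad)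
  then have "dyad l (image_unit q) \<preceq> dyad b (image_unit q)"
    using order dyad_weight_effect[OF q, of 0] dyad_weight_effect[OF q x] image_dyad_l[OF q] b
    by (metis order_refl weight_0 zero_le_one)
  then have "l \<le> b"
    using dyad_inner_self[OF image_unit(1)[OF q]] unfolding op_le_iff by metis
  then show ?thesis using weight_onto[OF l, of b] b by auto
qed

lemma onto_dyad_weight:
  assumes q: "norm q = 1" and y: "0 \<le> y" "y \<le> 1"
  shows "\<exists>x. 0 \<le> x \<and> x \<le> 1 \<and> \<phi> (dyad (weight l x) q) = dyad (weight l y) (image_unit q)"
proof -
  obtain t where t: "0 \<le> t" "t \<le> 1" "\<phi> (dyad t q) = dyad (weight l y) (image_unit q)"
    using onto_dyad_line[OF q, of "weight l y"] weight_bounds[OF y] l by auto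
  have e: "dyad t q \<in> effects" using q t by (simp add: dyad_effect_iff)
  have "dyad l (image_unit q) \<preceq> dyad (weight l y) (image_unit q)"
    using weight_bounds[OF y] by (simp add: dyad_le_dyad)
  then have "dyad l q \<preceq> dyad t q"
    using order[OF _ e] dyad_weight_effect[OF q, of 0] image_dyad_l[OF q] t
    by (metis order_refl weight_0 zero_le_one)
  then have "l \<le> t" using dyad_inner_self[OF q] unfolding op_le_iff by metis
  then show ?thesis using weight_onto[OF l, of t] t by auto
qed

text \<open>The action of \<open>\<phi>\<close> on the weights in \<open>[l, 1]\<close> on the line of \<open>q\<close>, in the coordinate
  \<open>weight l\<close>.\<close>

definition rescaling :: "'a \<Rightarrow> real \<Rightarrow> real" where
  "rescaling q x = (SOME y. 0 \<le> y \<and> y \<le> 1 \<and>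
     \<phi> (dyad (weight l x) q) = dyad (weight l y) (image_unit q))"

lemma rescaling:
  assumes "norm q = 1" "0 \<le> x" "x \<le> 1"
  shows "0 \<le> rescaling q x" "rescaling q x \<le> 1"
    "\<phi> (dyad (weight l x) q) = dyad (weight l (rescaling q x)) (image_unit q)"
  using someI_ex[OF image_dyad_weight[OF assms]] by (auto simp: rescaling_def)

lemma rescaling_le_iff:
  assumes q: "norm q = 1" and x: "0 \<le> x" "x \<le> 1" and y: "0 \<le> y" "y \<le> 1"
  shows "rescaling q x \<le> rescaling q y \<longleftrightarrow> x \<le> y"
proof -
  have "dyad (weight l x) q \<preceq> dyad (weight l y) q \<longleftrightarrow>
      dyad (weight l (rescaling q x)) (image_unit q) \<preceq> dyad (weight l (rescaling q y)) (image_unit q)"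
    using order[OF dyad_weight_effect[OF q x] dyad_weight_effect[OF q y]]
      rescaling(3)[OF q x] rescaling(3)[OF q y] by simp
  then show ?thesis
    using dyad_weight_le_iff[OF q x(2) y(2)] dyad_weight_le_iff[OF image_unit(1)[OF q]]
      rescaling(2)[OF q x] rescaling(2)[OF q y] by metis
qed

lemma rescaling_onto:
  assumes q: "norm q = 1" and y: "0 \<le> y" "y \<le> 1"
  shows "\<exists>x. 0 \<le> x \<and> x \<le> 1 \<and> rescaling q x = y"
proof -
  obtain x where x: "0 \<le> x" "x \<le> 1" "\<phi> (dyad (weight l x) q) = dyad (weight l y) (image_unit q)"
    using onto_dyad_weight[OF q y] by blast
  then have "dyad (weight l y) (image_unit q) = dyad (weight l (rescaling q x)) (image_unit q)"
    using rescaling(3)[OF q] by metis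
  then have "y = rescaling q x"
    using dyad_weight_le_iff[OF image_unit(1)[OF q]] y(2) rescaling(2)[OF q x(1,2)]
    by (metis op_le_refl order_antisym)
  then show ?thesis using x by blast
qed

lemma rescaling_0: assumes q: "norm q = 1" shows "rescaling q 0 = 0"
proof -
  obtain x where x: "0 \<le> x" "x \<le> 1" "rescaling q x = 0" using rescaling_onto[OF q, of 0] by auto
  then show ?thesis
    using rescaling_le_iff[OF q, of 0 x] rescaling(1)[OF q, of 0] by simp
qed

text \<open>At \<open>y = 1\<close> the image is \<open>l I + s|r><r|\<close> above the projection onto \<open>image_unit p\<close>; by the
  comparison formula this forces \<open>s\<close> to be maximal and \<open>r\<close> to be parallel to \<open>image_unit p\<close>.  The
  images for smaller \<open>y\<close> lie below that one.\<close>

lemma image_scalar_plus_dyad_1: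
  assumes p: "norm p = 1"
  shows "\<phi> (scalar_plus_dyad l 1 p) = scalar_plus_dyad l 1 (image_unit p)"
proof -
  have eq: "scalar_plus_dyad l y u = (\<lambda>x. l *\<^sub>R x + dyad (weight l y - l) u x)" for y and u :: 'a
    by (simp add: scalar_plus_dyad_def fun_eq_iff)
  have e: "scalar_plus_dyad l 1 p \<in> effects" using scalar_plus_dyad_effect[OF l _ _ p] by simp
  obtain s r where sr: "norm r = 1" "0 \<le> s"
    "\<phi> (scalar_plus_dyad l 1 p) = (\<lambda>x. l *\<^sub>R x + dyad s r x)"
    using image_add_dyad[OF fixed_scalar_effect, of "weight l 1 - l" p] e p l fixed unfolding eq by auto
  have "l + s \<le> 1"
  proof -
    have "(\<lambda>x. l *\<^sub>R x + dyad s r x) \<preceq> id" using effect[OF e] sr by (simp add: effects_iff)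
    then have "(l *\<^sub>R r + dyad s r r) \<bullet> r \<le> r \<bullet> r" by (simp add: op_le_iff)
    then show ?thesis
      using sr(1) by (simp add: inner_add_left dyad_inner_self power2_norm_eq_inner[symmetric])
  qed
  then obtain y where y: "0 \<le> y" "y \<le> 1" "weight l y = l + s"
    using weight_onto[OF l, of "l + s"] sr by auto
  then have img: "\<phi> (scalar_plus_dyad l 1 p) = scalar_plus_dyad l y r" using sr by (simp add: eq)
  have "dyad (weight l 1) p \<preceq> scalar_plus_dyad l 1 p"
    using dyad_le_scalar_plus_dyad_iff[OF l _ _ _ _ p p, of 1 1] p by (simp add: cinner_self_unit)
  then have "dyad (weight l 1) (image_unit p) \<preceq> scalar_plus_dyad l y r"
    using order[OF dyad_weight_effect[OF p, of 1] e] img image_unit(2)[OF p] l by simp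
  then have c: "1 \<le> (cmod (cinner r (image_unit p)))\<^sup>2 * y"
    using dyad_le_scalar_plus_dyad_iff[OF l _ _ y(1,2) sr(1) image_unit(1)[OF p], of 1] by simp
  have "(cmod (cinner r (image_unit p)))\<^sup>2 \<le> 1"
    using cinner_Cauchy_Schwarz[of r "image_unit p"] sr(1) image_unit(1)[OF p]
    by (simp add: power_le_one)
  then have "y = 1" "1 \<le> (cmod (cinner r (image_unit p)))\<^sup>2"
    using c y mult_mono[of "(cmod (cinner r (image_unit p)))\<^sup>2" 1 y y]
      mult_mono[of "(cmod (cinner r (image_unit p)))\<^sup>2" "(cmod (cinner r (image_unit p)))\<^sup>2" y 1]
    by auto
  then have "1 \<le> cmod (cinner r (image_unit p))"
    by (metis abs_le_square_iff abs_norm_cancel abs_one one_power2)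
  then have r: "r = cinner r (image_unit p) *\<^sub>C image_unit p"
    using cinner_Cauchy_Schwarz_eq[OF image_unit(1)[OF p], of r] sr(1) by simp
  then have "cmod (cinner r (image_unit p)) = 1"
    using sr(1) image_unit(1)[OF p] by (metis mult.right_neutral norm_scaleC)
  then have "dyad t r = dyad t (image_unit p)" for t
    using r dyad_phase by metis
  then show ?thesis using img \<open>y = 1\<close> by (simp add: eq)
qed

lemma image_scalar_plus_dyad:
  assumes p: "norm p = 1" and y: "0 \<le> y" "y \<le> 1"
  shows "\<exists>z. 0 \<le> z \<and> z \<le> 1 \<and> \<phi> (scalar_plus_dyad l y p) = scalar_plus_dyad l z (image_unit p)"
proof -
  have eq: "scalar_plus_dyad l y u = (\<lambda>x. l *\<^sub>R x + dyad (weight l y - l) u x)" for y and u :: 'a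
    by (simp add: scalar_plus_dyad_def fun_eq_iff)
  have e: "scalar_plus_dyad l y p \<in> effects" "scalar_plus_dyad l 1 p \<in> effects"
    using scalar_plus_dyad_effect[OF l _ _ p] y by simp_all
  have "weight l y \<le> weight l 1" using weight_le_iff[OF l] y by simp
  then have "scalar_plus_dyad l y p \<preceq> scalar_plus_dyad l 1 p"
    using dyad_le_dyad[of "weight l y - l" "weight l 1 - l" p]
    by (simp add: scalar_plus_dyad_def op_le_iff inner_add_left)
  then have le: "\<phi> (scalar_plus_dyad l y p) \<preceq> scalar_plus_dyad l 1 (image_unit p)"
    using order[OF e] image_scalar_plus_dyad_1[OF p] by simp
  obtain s r where sr: "norm r = 1" "0 \<le> s"
    "\<phi> (scalar_plus_dyad l y p) = (\<lambda>x. l *\<^sub>R x + dyad s r x)"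
    using image_add_dyad[OF fixed_scalar_effect, of "weight l y - l" p] e p weight_bounds[OF y] fixed
    unfolding eq by auto
  have "dyad s r \<preceq> dyad (1 - l) (image_unit p)"
    using le l unfolding sr(3) by (simp add: scalar_plus_dyad_def op_le_iff inner_add_left)
  then obtain b where b: "0 \<le> b" "b \<le> 1 - l" "dyad s r = dyad b (image_unit p)"
    using positive_le_dyad[OF positive_dyad[OF sr(2)] image_unit(1)[OF p]] by blast
  then obtain z where "0 \<le> z" "z \<le> 1" "weight l z = l + b"
    using weight_onto[OF l, of "l + b"] by auto
  then show ?thesis using sr(3) b(3) by (intro exI[of _ z]) (simp add: eq)
qed

text \<open>The comparison formula is preserved by \<open>\<phi>\<close>, and \<open>rescaling q\<close> maps \<open>[0, 1]\<close> onto itself, so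
  the thresholds on both sides correspond.  The case \<open>p = q\<close> identifies the scale of the
  operators \<open>scalar_plus_dyad l y p\<close> with the one of the dyads.\<close>

lemma rescaling_transition:
  assumes p: "norm p = 1" and q: "norm q = 1" and y: "0 \<le> y" "y \<le> 1"
  shows "rescaling q ((cmod (cinner p q))\<^sup>2 * y) =
    (cmod (cinner (image_unit p) (image_unit q)))\<^sup>2 * rescaling p y"
proof -
  obtain z where z: "0 \<le> z" "z \<le> 1"
    "\<phi> (scalar_plus_dyad l y p) = scalar_plus_dyad l z (image_unit p)"
    using image_scalar_plus_dyad[OF p y] by blast
  have threshold: "rescaling q ((cmod (cinner p q))\<^sup>2 * y) =
      (cmod (cinner (image_unit p) (image_unit q)))\<^sup>2 * z" if q: "norm q = 1" for q
  proof -
    define c c' where "c = (cmod (cinner p q))\<^sup>2"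
      and "c' = (cmod (cinner (image_unit p) (image_unit q)))\<^sup>2"
    have "c \<le> 1" "c' \<le> 1"
      using cinner_Cauchy_Schwarz[of p q] cinner_Cauchy_Schwarz[of "image_unit p" "image_unit q"]
        p q image_unit(1) by (simp_all add: c_def c'_def power_le_one)
    then have cy: "0 \<le> c * y" "c * y \<le> 1" and cz: "0 \<le> c' * z" "c' * z \<le> 1"
      using y z by (simp_all add: c_def c'_def mult_le_one)
    have iff: "x \<le> c * y \<longleftrightarrow> rescaling q x \<le> c' * z" if x: "0 \<le> x" "x \<le> 1" for x
    proof -
      have "dyad (weight l x) q \<preceq> scalar_plus_dyad l y p \<longleftrightarrow>
          dyad (weight l (rescaling q x)) (image_unit q) \<preceq> scalar_plus_dyad l z (image_unit p)"
        using order[OF dyad_weight_effect[OF q x] scalar_plus_dyad_effect[OF l y p]]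
          rescaling(3)[OF q x] z(3) by simp
      then show ?thesis
        using dyad_le_scalar_plus_dyad_iff[OF l x y p q]
          dyad_le_scalar_plus_dyad_iff[OF l rescaling(1,2)[OF q x] z(1,2)
            image_unit(1)[OF p] image_unit(1)[OF q]]
        by (simp add: c_def c'_def)
    qed
    obtain x where x: "0 \<le> x" "x \<le> 1" "rescaling q x = c' * z"
      using rescaling_onto[OF q cz] by blast
    have "rescaling q (c * y) \<le> c' * z" using iff[OF cy] by simp
    moreover have "x \<le> c * y" using iff[OF x(1,2)] x(3) by simp
    then have "c' * z \<le> rescaling q (c * y)" using rescaling_le_iff[OF q x(1,2) cy] x(3) by simp
    ultimately show ?thesis by (simp add: c_def c'_def)
  qed
  have "rescaling p y = z"
    using threshold[OF p] by (simp add: cinner_self_unit p image_unit(1))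
  then show ?thesis using threshold[OF q] by simp
qed

lemma rescaling_1: assumes "norm q = 1" shows "rescaling q 1 = 1"
proof -
  obtain x where x: "0 \<le> x" "x \<le> 1" "rescaling q x = 1" using rescaling_onto[OF assms, of 1] by auto
  then show ?thesis
    using rescaling_le_iff[OF assms x(1,2), of 1] rescaling(2)[OF assms, of 1] by simp
qed

lemma rescaling_eq_transition:
  assumes "norm p = 1" "norm q = 1"
  shows "rescaling q ((cmod (cinner p q))\<^sup>2) = (cmod (cinner (image_unit p) (image_unit q)))\<^sup>2"
  using rescaling_transition[OF assms, of 1] rescaling_1[OF assms(1)] by simp

text \<open>The numbers \<open>x\<close> and \<open>1 - x\<close> are the transition probabilities of \<open>q\<close> to two orthogonal lines in a
  plane through \<open>q\<close>.  The images of these lines are orthogonal, and their span contains the image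
  of \<open>q\<close>.\<close>

lemma rescaling_complement:
  assumes q: "norm q = 1" and x: "0 \<le> x" "x \<le> 1"
  shows "rescaling q (1 - x) = 1 - rescaling q x"
proof -
  obtain e where e: "norm e = 1" "cinner q e = 0" using two_dimensional[OF q] by blast
  obtain p r a b where pr: "norm p = 1" "norm r = 1" "cinner p r = 0"
    "(cmod (cinner p q))\<^sup>2 = x" "(cmod (cinner r q))\<^sup>2 = 1 - x" "q = a *\<^sub>R p + b *\<^sub>R r"
    using unit_splitting[OF q e x] by blast
  have "cinner (image_unit p) (image_unit r) = 0"
    using rescaling_eq_transition[OF pr(1,2)] pr(3) rescaling_0[OF pr(2)] by simp
  then have "(cmod (cinner (image_unit q) (image_unit p)))\<^sup>2 +
      (cmod (cinner (image_unit q) (image_unit r)))\<^sup>2 = 1"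
    using image_unit_Parseval[OF q pr(1,2) _ pr(6)] by blast
  then show ?thesis
    using rescaling_eq_transition[OF pr(1) q] rescaling_eq_transition[OF pr(2) q] pr(4,5)
    by (simp add: cmod_cinner_commute[of _ "image_unit q"])
qed

text \<open>A vector \<open>p\<close> at transition probability \<open>1/2\<close> from \<open>q\<close> keeps it, because reflection fixes
  \<open>1/2\<close>.\<close>

lemma rescaling_half:
  assumes q: "norm q = 1"
  shows "\<exists>p. norm p = 1 \<and> (\<forall>y. 0 \<le> y \<and> y \<le> 1 \<longrightarrow> rescaling q (y / 2) = rescaling p y / 2)"
proof -
  obtain e where e: "norm e = 1" "cinner q e = 0" using two_dimensional[OF q] by blast
  obtain p where p: "norm p = 1" "(cmod (cinner p q))\<^sup>2 = 1 / 2"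
    using unit_splitting[OF q e, of "1 / 2"] by auto
  have "rescaling q (1 / 2) = 1 / 2" using rescaling_complement[OF q, of "1 / 2"] by simp
  then have "(cmod (cinner (image_unit p) (image_unit q)))\<^sup>2 = 1 / 2"
    using rescaling_eq_transition[OF p(1) q] p(2) by simp
  then show ?thesis using rescaling_transition[OF p(1) q] p by auto
qed

text \<open>Halving and reflection move every deviation from the identity into \<open>[0, 1/2]\<close>, where it is
  half of another deviation.\<close>

lemma rescaling_approx:
  assumes "norm q = 1" "0 \<le> x" "x \<le> 1"
  shows "\<bar>rescaling q x - x\<bar> \<le> (1 / 2) ^ n"
  using assms
proof (induction n arbitrary: q x)
  case 0
  then show ?case using rescaling[OF 0] by auto
next
  case (Suc n)
  have low: "\<bar>rescaling q x - x\<bar> \<le> (1 / 2) ^ Suc n" if x: "0 \<le> x" "x \<le> 1 / 2" for x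
  proof -
    obtain p where p: "norm p = 1" "rescaling q (2 * x / 2) = rescaling p (2 * x) / 2"
      using rescaling_half[OF Suc.prems(1)] x
      by (metis div_by_1 le_divide_eq_numeral1(1) mult.commute mult_nonneg_nonneg zero_le_numeral)
    have "rescaling q x - x = (rescaling p (2 * x) - 2 * x) / 2" using p(2) by simp
    then have "\<bar>rescaling q x - x\<bar> = \<bar>rescaling p (2 * x) - 2 * x\<bar> / 2"
      by (simp only: abs_divide abs_numeral)
    then show ?thesis using Suc.IH[OF p(1), of "2 * x"] x by simp
  qed
  show ?case
  proof (cases "x \<le> 1 / 2")
    case True
    then show ?thesis using low Suc.prems by simp
  next
    case False
    then show ?thesis
      using low[of "1 - x"] rescaling_complement[OF Suc.prems] Suc.prems
      by (simp add: abs_minus_commute)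
  qed
qed

lemma rescaling_id:
  assumes "norm q = 1" "0 \<le> x" "x \<le> 1" shows "rescaling q x = x"
proof -
  have "(\<lambda>n. (1 / 2 :: real) ^ n) \<longlonglongrightarrow> 0" by (rule LIMSEQ_power_zero) simp
  then have "\<bar>rescaling q x - x\<bar> \<le> 0"
    by (rule LIMSEQ_le_const) (use rescaling_approx[OF assms] in blast)
  then show ?thesis by simp
qed

lemma transition_preserved:
  assumes "norm p = 1" "norm q = 1"
  shows "cmod (cinner (image_unit p) (image_unit q)) = cmod (cinner p q)"
proof -
  have "(cmod (cinner p q))\<^sup>2 \<le> 1"
    using cinner_Cauchy_Schwarz[of p q] assms by (simp add: power_le_one)
  then show ?thesis
    using rescaling_eq_transition[OF assms] rescaling_id[OF assms(2)] by (simp add: power2_eq_iff_nonneg)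
qed

lemma image_dyad_above_l:
  assumes "norm q = 1" "l \<le> t" "t \<le> 1" shows "\<phi> (dyad t q) = dyad t (image_unit q)"
proof -
  obtain x where "0 \<le> x" "x \<le> 1" "weight l x = t" using weight_onto[OF l assms(2,3)] by auto
  then show ?thesis using rescaling(3)[OF assms(1)] rescaling_id[OF assms(1)] by metis
qed

end

section \<open>Wigner's theorem\<close>

text \<open>The map \<open>\<kappa>\<close> is the identity for unitary and the conjugation for antiunitary operators.\<close>

definition wigner_symmetry :: "(complex \<Rightarrow> complex) \<Rightarrow> ('a::chilbert_space \<Rightarrow> 'a) \<Rightarrow> bool" where
  "wigner_symmetry \<kappa> U \<longleftrightarrow> (\<kappa> = (\<lambda>c. c) \<or> \<kappa> = cnj) \<and> (\<forall>x y. U (x + y) = U x + U y) \<and>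
     (\<forall>c x. U (c *\<^sub>C x) = \<kappa> c *\<^sub>C U x) \<and> (\<forall>x. norm (U x) = norm x) \<and> surj U"

lemma parallel_of_cmod_cinner:
  assumes "norm u = norm v" "cmod (cinner u v) = norm u * norm (v::'a::chilbert_space)"
  shows "\<exists>c. cmod c = 1 \<and> u = c *\<^sub>C v"
proof (cases "v = 0")
  case True
  then have "cmod 1 = 1 \<and> u = 1 *\<^sub>C v" using assms(1) by simp
  then show ?thesis by blast
next
  case False
  define q where "q = v /\<^sub>R norm v"
  have q: "norm q = 1" "v = norm v *\<^sub>R q" using False by (simp_all add: q_def)
  have "cmod (cinner u q) = norm u"
    using assms False by (simp add: q_def cinner_scaleR_right norm_mult norm_inverse)
  then have u: "u = cinner u q *\<^sub>C q" by (intro cinner_Cauchy_Schwarz_eq q) simp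
  also have "\<dots> = (cinner u q / norm v) *\<^sub>C v"
    using False by (simp add: q_def scaleC_scaleR scaleC_of_real_mult[symmetric] divide_inverse mult.commute)
  finally show ?thesis
    using \<open>cmod (cinner u q) = norm u\<close> False assms(1)
    by (intro exI[of _ "cinner u q / norm v"]) (simp add: norm_divide)
qed

text \<open>Bargmann's normalization: \<open>V\<close> is the representative of \<open>x \<mapsto> e + x\<close>, on the orthogonal
  complement of a unit vector \<open>e\<close>, with the component along the image of \<open>e\<close> removed.  The term \<open>1\<close>
  makes the modulus \<open>\<bar>1 + <x, y>\<bar>\<close> see the phase of \<open><x, y>\<close>: comparing \<open>x\<close> with \<open>2 x\<close> recovers
  the real part.\<close>

locale bargmann_map =
  fixes V :: "'a::chilbert_space \<Rightarrow> 'a" and e :: 'a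
  assumes modulus: "\<And>x y. cinner x e = 0 \<Longrightarrow> cinner y e = 0 \<Longrightarrow>
    cmod (1 + cinner (V x) (V y)) = cmod (1 + cinner x y)"
begin

lemma perp_closed:
  assumes "cinner x e = 0" "cinner y e = 0"
  shows "cinner (x + y) e = 0" "cinner (c *\<^sub>C x) e = 0" "cinner (r *\<^sub>R x) e = 0"
  using assms by (simp_all add: cinner_algebra)

lemma norm_V: assumes x: "cinner x e = 0" shows "norm (V x) = norm x"
proof -
  have eq: "cmod (1 + cinner z z) = 1 + (norm z)\<^sup>2" for z :: 'a
  proof -
    have "1 + cinner z z = of_real (1 + (norm z)\<^sup>2)" by (simp add: cinner_self)
    then show ?thesis by (simp only: norm_of_real) simp
  qed
  have "(norm (V x))\<^sup>2 = (norm x)\<^sup>2" using modulus[OF x x] by (simp add: eq)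
  then show ?thesis by (rule power2_eq_imp_eq) simp_all
qed

lemma cmod_1_plus: "(cmod (1 + z))\<^sup>2 = 1 + 2 * Re z + (cmod z)\<^sup>2"
  unfolding cmod_power2 by (simp add: power2_eq_square algebra_simps)

lemma V_double: assumes x: "cinner x e = 0" shows "V (2 *\<^sub>R x) = 2 *\<^sub>R V x"
proof -
  have x2: "cinner (2 *\<^sub>R x) e = 0" using x by (simp add: cinner_algebra)
  define z where "z = cinner (V (2 *\<^sub>R x)) (V x)"
  have "(cmod (1 + z))\<^sup>2 = (1 + 2 * (norm x)\<^sup>2)\<^sup>2"
  proof -
    have "1 + cinner (2 *\<^sub>R x) x = of_real (1 + 2 * (norm x)\<^sup>2)"
      by (simp add: cinner_scaleR_left cinner_self)
    then have "cmod (1 + z) = 1 + 2 * (norm x)\<^sup>2"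
      using modulus[OF x2 x] by (simp only: z_def norm_of_real) simp
    then show ?thesis by simp
  qed
  moreover have "(cmod z)\<^sup>2 \<le> (2 * (norm x)\<^sup>2)\<^sup>2"
    using cinner_Cauchy_Schwarz[of "V (2 *\<^sub>R x)" "V x"] norm_V[OF x] norm_V[OF x2]
    by (intro power_mono) (simp_all add: z_def power2_eq_square)
  ultimately have "2 * (norm x)\<^sup>2 \<le> Re z"
    unfolding cmod_1_plus by (simp add: power2_eq_square algebra_simps)
  then have "2 * (norm x)\<^sup>2 \<le> V (2 *\<^sub>R x) \<bullet> V x" by (simp add: z_def Re_cinner)
  moreover have "(norm (V (2 *\<^sub>R x) - 2 *\<^sub>R V x))\<^sup>2 =
      (norm (V (2 *\<^sub>R x)))\<^sup>2 + 4 * (norm (V x))\<^sup>2 - 4 * (V (2 *\<^sub>R x) \<bullet> V x)"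
    unfolding power2_norm_eq_inner
    by (simp add: inner_diff_left inner_diff_right inner_commute algebra_simps)
  ultimately have "(norm (V (2 *\<^sub>R x) - 2 *\<^sub>R V x))\<^sup>2 \<le> 0"
    by (simp add: norm_V[OF x] norm_V[OF x2] power_mult_distrib)
  then show ?thesis by simp
qed

lemma V_inner:
  assumes x: "cinner x e = 0" and y: "cinner y e = 0"
  shows "V x \<bullet> V y = x \<bullet> y" "cmod (cinner (V x) (V y)) = cmod (cinner x y)"
proof -
  define z w where "z = cinner (V x) (V y)" and "w = cinner x y"
  have "(cmod (1 + z))\<^sup>2 = (cmod (1 + w))\<^sup>2" using modulus[OF x y] by (simp add: z_def w_def)
  then have 1: "2 * Re z + (cmod z)\<^sup>2 = 2 * Re w + (cmod w)\<^sup>2" by (simp add: cmod_1_plus)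
  have "(cmod (1 + 2 * z))\<^sup>2 = (cmod (1 + 2 * w))\<^sup>2"
    using modulus[OF perp_closed(3)[OF x x, of 2] y]
    by (simp add: z_def w_def V_double[OF x] cinner_scaleR_left)
  then have 2: "4 * Re z + 4 * (cmod z)\<^sup>2 = 4 * Re w + 4 * (cmod w)\<^sup>2"
    by (simp add: cmod_1_plus norm_mult power_mult_distrib)
  have "Re z = Re w" using 1 2 by simp
  then show "V x \<bullet> V y = x \<bullet> y" by (simp add: z_def w_def Re_cinner)
  have "(cmod z)\<^sup>2 = (cmod w)\<^sup>2" using 1 2 by linarith
  then have "cmod z = cmod w" by (rule power2_eq_imp_eq) simp_all
  then show "cmod (cinner (V x) (V y)) = cmod (cinner x y)" by (simp add: z_def w_def)
qed

lemma V_add: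
  assumes x: "cinner x e = 0" and y: "cinner y e = 0"
  shows "V (x + y) = V x + V y"
proof -
  note xy = perp_closed(1)[OF x y]
  have "(V (x + y) - (V x + V y)) \<bullet> (V (x + y) - (V x + V y)) = 0"
    by (simp add: inner_diff_left inner_diff_right inner_add_left inner_add_right
        V_inner(1) x y xy)
  then show ?thesis by simp
qed

lemma V_scaleR:
  assumes x: "cinner x e = 0"
  shows "V (r *\<^sub>R x) = r *\<^sub>R V x"
proof -
  note rx = perp_closed(3)[OF x x, of r]
  have "(V (r *\<^sub>R x) - r *\<^sub>R V x) \<bullet> (V (r *\<^sub>R x) - r *\<^sub>R V x) = 0"
    by (simp add: inner_diff_left inner_diff_right V_inner(1) x rx)
  then show ?thesis by simp
qed

lemma V_i_cases:
  assumes x: "cinner x e = 0"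
  shows "V (\<i> *\<^sub>C x) = \<i> *\<^sub>C V x \<or> V (\<i> *\<^sub>C x) = (- \<i>) *\<^sub>C V x"
proof -
  note ix = perp_closed(2)[OF x x, of \<i>]
  define z where "z = cinner (V (\<i> *\<^sub>C x)) (V x)"
  have "Re z = 0"
    using V_inner(1)[OF ix x] Re_cinner[of "\<i> *\<^sub>C x" x]
    by (simp add: z_def Re_cinner[symmetric] cinner_scaleC_left cinner_self)
  moreover have "cmod z = (norm x)\<^sup>2"
    using V_inner(2)[OF ix x] by (simp add: z_def cinner_scaleC_left cinner_self norm_mult norm_power)
  ultimately have z: "\<bar>Im z\<bar> = (norm x)\<^sup>2" by (simp add: cmod_def)
  have n: "norm (V (\<i> *\<^sub>C x)) = norm x" "norm (V x) = norm x"
    using norm_V[OF ix] norm_V[OF x] by (simp_all add: norm_scaleC)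
  have self: "V (\<i> *\<^sub>C x) \<bullet> V (\<i> *\<^sub>C x) = (norm x)\<^sup>2"
    "(\<i> *\<^sub>C V x) \<bullet> (\<i> *\<^sub>C V x) = (norm x)\<^sup>2"
    by (simp_all add: power2_norm_eq_inner[symmetric] n norm_scaleC)
  have i: "V (\<i> *\<^sub>C x) \<bullet> (\<i> *\<^sub>C V x) = Im z" by (simp add: z_def Im_cinner)
  then have i': "(\<i> *\<^sub>C V x) \<bullet> V (\<i> *\<^sub>C x) = Im z" by (simp only: inner_commute)
  have "(norm (V (\<i> *\<^sub>C x) - \<i> *\<^sub>C V x))\<^sup>2 = 2 * (norm x)\<^sup>2 - 2 * Im z"
       "(norm (V (\<i> *\<^sub>C x) + \<i> *\<^sub>C V x))\<^sup>2 = 2 * (norm x)\<^sup>2 + 2 * Im z"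
    unfolding power2_norm_eq_inner[of "V (\<i> *\<^sub>C x) - \<i> *\<^sub>C V x"]
      power2_norm_eq_inner[of "V (\<i> *\<^sub>C x) + \<i> *\<^sub>C V x"]
    by (simp_all add: inner_diff_left inner_diff_right inner_add_left inner_add_right i i' self)
  then have "V (\<i> *\<^sub>C x) - \<i> *\<^sub>C V x = 0 \<or> V (\<i> *\<^sub>C x) + \<i> *\<^sub>C V x = 0"
  proof -
    have "Im z = (norm x)\<^sup>2 \<or> Im z = - (norm x)\<^sup>2" using z by linarith
    then show ?thesis
      using \<open>(norm (V (\<i> *\<^sub>C x) - \<i> *\<^sub>C V x))\<^sup>2 = _\<close>
        \<open>(norm (V (\<i> *\<^sub>C x) + \<i> *\<^sub>C V x))\<^sup>2 = _\<close> by auto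
  qed
  then show ?thesis by (auto simp: eq_neg_iff_add_eq_0)
qed

text \<open>Otherwise the orthogonal complement of \<open>e\<close> would be the union of two proper real
  subspaces.\<close>

lemma V_i_uniform:
  "\<exists>s\<in>{\<i>, - \<i>}. \<forall>x. cinner x e = 0 \<longrightarrow> V (\<i> *\<^sub>C x) = s *\<^sub>C V x"
proof (rule ccontr)
  assume "\<not> ?thesis"
  then obtain x y where x: "cinner x e = 0" "V (\<i> *\<^sub>C x) \<noteq> \<i> *\<^sub>C V x"
    and y: "cinner y e = 0" "V (\<i> *\<^sub>C y) \<noteq> (- \<i>) *\<^sub>C V y" by blast
  then have xs: "V (\<i> *\<^sub>C x) = - (\<i> *\<^sub>C V x)" and ys: "V (\<i> *\<^sub>C y) = \<i> *\<^sub>C V y"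
    using V_i_cases by fastforce+
  have "V (\<i> *\<^sub>C (x + y)) = - (\<i> *\<^sub>C V x) + \<i> *\<^sub>C V y"
    using V_add[OF perp_closed(2)[OF x(1) x(1)] perp_closed(2)[OF y(1) y(1)], of \<i> \<i>] xs ys
    by (simp add: complex_vector.scale_right_distrib)
  then have "\<i> *\<^sub>C V x = 0 \<or> \<i> *\<^sub>C V y = 0"
  proof -
    assume a: "V (\<i> *\<^sub>C (x + y)) = - (\<i> *\<^sub>C V x) + \<i> *\<^sub>C V y"
    have half: "u = 0" if "u = - u" for u :: 'a
      using that by (metis add.right_inverse scaleR_2 scaleR_eq_0_iff zero_neq_numeral)
    from V_i_cases[OF perp_closed(1)[OF x(1) y(1)]] show ?thesis
    proof
      assume "V (\<i> *\<^sub>C (x + y)) = \<i> *\<^sub>C V (x + y)"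
      then have "\<i> *\<^sub>C V x = - (\<i> *\<^sub>C V x)"
        using a by (simp add: V_add[OF x(1) y(1)] complex_vector.scale_right_distrib)
      then show ?thesis using half by blast
    next
      assume "V (\<i> *\<^sub>C (x + y)) = (- \<i>) *\<^sub>C V (x + y)"
      then have "\<i> *\<^sub>C V y = - (\<i> *\<^sub>C V y)"
        using a by (simp add: V_add[OF x(1) y(1)] complex_vector.scale_right_distrib)
      then show ?thesis using half by blast
    qed
  qed
  then show False
  proof
    assume "\<i> *\<^sub>C V x = 0"
    then show False using x(2) xs by simp
  next
    assume "\<i> *\<^sub>C V y = 0"
    then show False using y(2) ys by simp
  qed
qed

lemma V_scaleC:
  "\<exists>\<kappa>. (\<kappa> = (\<lambda>c. c) \<or> \<kappa> = cnj) \<and> (\<forall>c x. cinner x e = 0 \<longrightarrow> V (c *\<^sub>C x) = \<kappa> c *\<^sub>C V x)"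
proof -
  obtain s where s: "s = \<i> \<or> s = - \<i>" and Vi: "\<And>x. cinner x e = 0 \<Longrightarrow> V (\<i> *\<^sub>C x) = s *\<^sub>C V x"
    using V_i_uniform by blast
  have split: "c *\<^sub>C u = Re c *\<^sub>R u + Im c *\<^sub>R (\<i> *\<^sub>C u)" for c and u :: 'a
  proof -
    have "c *\<^sub>C u = (of_real (Re c) + of_real (Im c) * \<i>) *\<^sub>C u"
      by (simp add: complex_eq_iff)
    then show ?thesis by (simp only: scaleC_add_left scaleC_of_real scaleC_of_real_mult)
  qed
  have V: "V (c *\<^sub>C x) = (of_real (Re c) + of_real (Im c) * s) *\<^sub>C V x" if x: "cinner x e = 0" for c x
  proof -
    note ix = perp_closed(2)[OF x x, of \<i>]
    have "V (c *\<^sub>C x) = Re c *\<^sub>R V x + Im c *\<^sub>R (s *\<^sub>C V x)"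
      using V_add[OF perp_closed(3)[OF x x, of "Re c"] perp_closed(3)[OF ix ix, of "Im c"]]
      by (simp only: split[of c x] V_scaleR[OF x] V_scaleR[OF ix] Vi[OF x])
    then show ?thesis by (simp only: scaleC_add_left scaleC_of_real scaleC_of_real_mult)
  qed
  have "of_real (Re c) + of_real (Im c) * \<i> = c" "of_real (Re c) + of_real (Im c) * (- \<i>) = cnj c" for c
    by (simp_all add: complex_eq_iff)
  then have "(\<forall>c x. cinner x e = 0 \<longrightarrow> V (c *\<^sub>C x) = c *\<^sub>C V x) \<or>
      (\<forall>c x. cinner x e = 0 \<longrightarrow> V (c *\<^sub>C x) = cnj c *\<^sub>C V x)"
    using s by (auto simp only: V)
  then show ?thesis
  proof
    assume "\<forall>c x. cinner x e = 0 \<longrightarrow> V (c *\<^sub>C x) = c *\<^sub>C V x"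
    then show ?thesis by (intro exI[of _ "\<lambda>c. c"] conjI disjI1 refl)
  next
    assume "\<forall>c x. cinner x e = 0 \<longrightarrow> V (c *\<^sub>C x) = cnj c *\<^sub>C V x"
    then show ?thesis by (intro exI[of _ cnj] conjI disjI2 refl)
  qed
qed

end

text \<open>The operator \<open>a e + x \<mapsto> \<kappa>(a) E + V x\<close>, with \<open>E\<close> the image of \<open>e\<close>, induces the given map of lines:
  for \<open>a \<noteq> 0\<close> the vector \<open>a e + x\<close> is parallel to a normalized one \<open>e + x'\<close>, whose image line is
  spanned by \<open>E + V x'\<close>; for \<open>a = 0\<close> the transition probability between \<open>x\<close> and \<open>e + x\<close> decides.\<close>

theorem wigner:
  fixes \<Psi> :: "'a::chilbert_space \<Rightarrow> 'a"
  assumes pres: "\<And>x y. cmod (cinner (\<Psi> x) (\<Psi> y)) = cmod (cinner x y)"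
    and onto: "\<And>y. \<exists>c x. y = c *\<^sub>C \<Psi> x" and e: "norm (e::'a) = 1"
  shows "\<exists>\<kappa> U. wigner_symmetry \<kappa> U \<and> (\<forall>x. \<exists>c. cmod c = 1 \<and> \<Psi> x = c *\<^sub>C U x)"
proof -
  have norm_\<Psi>: "norm (\<Psi> x) = norm x" for x
    using pres[of x x] by (simp add: cinner_self norm_power)
  define E \<alpha> W V where "E = \<Psi> e" and "\<alpha> = (\<lambda>x. cinner (\<Psi> (e + x)) E)"
    and "W = (\<lambda>x. cnj (\<alpha> x) *\<^sub>C \<Psi> (e + x))" and "V = (\<lambda>x. W x - E)"
  have E: "norm E = 1" "cinner E E = 1" by (simp_all add: E_def norm_\<Psi> e cinner_self)
  have \<alpha>: "cmod (\<alpha> x) = 1" if "cinner x e = 0" for x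
    using that pres[of "e + x" e] e by (simp add: \<alpha>_def E_def cinner_add_left cinner_self)
  have WE: "cinner (W x) E = 1" if "cinner x e = 0" for x
    using \<alpha>[OF that] mult_cnj_self(2)[of "\<alpha> x"] by (simp add: W_def cinner_scaleC_left \<alpha>_def)
  have VE: "cinner (V x) E = 0" if "cinner x e = 0" for x
    using WE[OF that] E by (simp add: V_def cinner_diff_left)
  have W\<Psi>: "cmod (cinner (\<Psi> z) (W x)) = cmod (cinner z (e + x))" if "cinner x e = 0" for x z
    using \<alpha>[OF that] pres[of z "e + x"] by (simp add: W_def cinner_scaleC_right norm_mult)
  interpret bargmann_map V e
  proof
    fix x y assume x: "cinner x e = 0" and y: "cinner y e = 0"
    have "cinner e y = 0" using y by (metis cinner_commute complex_cnj_zero)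
    have "cinner E (W y) = 1" using WE[OF y] by (metis cinner_commute complex_cnj_one)
    then have "1 + cinner (V x) (V y) = cinner (W x) (W y)"
      using WE[OF x] E by (simp add: V_def cinner_algebra)
    moreover have "cmod (cinner (W x) (W y)) = cmod (cinner (e + x) (e + y))"
    proof -
      have "cmod (cinner (cnj (\<alpha> x) *\<^sub>C \<Psi> (e + x)) (W y)) = cmod (cinner (\<Psi> (e + x)) (W y))"
        using \<alpha>[OF x] by (simp add: cinner_scaleC_left norm_mult)
      then show ?thesis using W\<Psi>[OF y, of "e + x"] by (simp add: W_def)
    qed
    moreover have "cinner (e + x) (e + y) = 1 + cinner x y"
      using x \<open>cinner e y = 0\<close> e by (simp add: cinner_algebra cinner_self)
    ultimately show "cmod (1 + cinner (V x) (V y)) = cmod (1 + cinner x y)" by simp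
  qed
  obtain \<kappa> where \<kappa>: "\<kappa> = (\<lambda>c. c) \<or> \<kappa> = cnj"
    and V\<kappa>: "\<And>c x. cinner x e = 0 \<Longrightarrow> V (c *\<^sub>C x) = \<kappa> c *\<^sub>C V x"
    using V_scaleC by (elim exE conjE) (rule that, auto)
  have \<kappa>_simps: "\<kappa> (c + d) = \<kappa> c + \<kappa> d" "\<kappa> (c * d) = \<kappa> c * \<kappa> d" "cmod (\<kappa> c) = cmod c"
    "\<kappa> (\<kappa> c) = c" "\<kappa> 0 = 0" for c d
    using \<kappa> by auto
  define P where "P = (\<lambda>z. z - cinner z e *\<^sub>C e)"
  have Pe: "cinner (P z) e = 0" for z
    by (simp add: P_def cinner_algebra cinner_self_unit[OF e])
  define U where "U = (\<lambda>z. \<kappa> (cinner z e) *\<^sub>C E + V (P z))"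
  have U_add: "U (x + y) = U x + U y" for x y
  proof -
    have "P (x + y) = P x + P y"
      by (simp add: P_def cinner_add_left scaleC_add_left)
    then show ?thesis
      by (simp add: U_def V_add Pe cinner_add_left \<kappa>_simps scaleC_add_left)
  qed
  have U_scale: "U (c *\<^sub>C x) = \<kappa> c *\<^sub>C U x" for c x
  proof -
    have "P (c *\<^sub>C x) = c *\<^sub>C P x"
      by (simp add: P_def cinner_scaleC_left complex_vector.scale_right_diff_distrib)
    then show ?thesis
      by (simp add: U_def V\<kappa> Pe cinner_scaleC_left \<kappa>_simps complex_vector.scale_right_distrib)
  qed
  have norm_U: "norm (U z) = norm z" for z
  proof -
    have "(norm (U z))\<^sup>2 = (cmod (cinner z e))\<^sup>2 + (norm (V (P z)))\<^sup>2"
    proof -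
      have "cinner (U z) E = \<kappa> (cinner z e)"
        using VE[OF Pe] E by (simp add: U_def cinner_algebra)
      then show ?thesis
        using norm_diff_projection[OF E(1), of "U z"] by (simp add: U_def \<kappa>_simps)
    qed
    also have "norm (V (P z)) = norm (P z)" by (rule norm_V[OF Pe])
    also have "(cmod (cinner z e))\<^sup>2 + (norm (P z))\<^sup>2 = (norm z)\<^sup>2"
      using norm_diff_projection[OF e, of z] by (simp add: P_def)
    finally show ?thesis by (rule power2_eq_imp_eq) simp_all
  qed
  have ray: "\<exists>c. cmod c = 1 \<and> \<Psi> z = c *\<^sub>C U z" for z
  proof (rule parallel_of_cmod_cinner)
    show "norm (\<Psi> z) = norm (U z)" by (simp add: norm_\<Psi> norm_U)
    define a where "a = cinner z e"
    have z: "z = a *\<^sub>C e + P z" by (simp add: P_def a_def)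
    have "cmod (cinner (\<Psi> z) (U z)) = cmod (cinner z z)"
    proof (cases "a = 0")
      case True
      have "cinner (\<Psi> z) E = 0" using pres[of z e] True by (simp add: E_def a_def)
      then have "cinner (\<Psi> z) (U z) = cinner (\<Psi> z) (W (P z))"
        using True by (simp add: U_def a_def[symmetric] \<kappa>_simps V_def cinner_diff_right)
      moreover have "P z = z" using True by (simp add: P_def a_def[symmetric])
      ultimately show ?thesis
        using W\<Psi>[OF Pe, of z z] True by (simp add: a_def cinner_add_right)
    next
      case False
      define x where "x = (1 / a) *\<^sub>C P z"
      have x: "cinner x e = 0" using Pe by (simp add: x_def cinner_scaleC_left)
      have ax: "a *\<^sub>C x = P z" using False complex_vector.scale_one[of "P z"] by (simp add: x_def)
      have "U z = \<kappa> a *\<^sub>C (E + V x)"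
        using V\<kappa>[OF x, of a] by (simp add: U_def a_def[symmetric] ax complex_vector.scale_right_distrib)
      then have "U z = \<kappa> a *\<^sub>C W x" by (simp add: V_def)
      then have "cmod (cinner (\<Psi> z) (U z)) = cmod a * cmod (cinner z (e + x))"
        using W\<Psi>[OF x, of z] by (simp add: cinner_scaleC_right norm_mult \<kappa>_simps)
      also have "\<dots> = cmod (cinner z (a *\<^sub>C (e + x)))" by (simp add: cinner_scaleC_right norm_mult)
      also have "a *\<^sub>C (e + x) = z" using z ax by (simp add: scaleC_add_right)
      finally show ?thesis .
    qed
    then show "cmod (cinner (\<Psi> z) (U z)) = norm (\<Psi> z) * norm (U z)"
      by (simp add: norm_\<Psi> norm_U cinner_self norm_mult power2_eq_square)
  qed
  have "surj U"
    unfolding surj_def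
  proof
    fix y
    obtain c x where y: "y = c *\<^sub>C \<Psi> x" using onto by blast
    obtain d where "\<Psi> x = d *\<^sub>C U x" using ray by blast
    then have "y = U (\<kappa> (c * d) *\<^sub>C x)" by (simp add: y U_scale \<kappa>_simps)
    then show "\<exists>x. y = U x" by blast
  qed
  then have "wigner_symmetry \<kappa> U"
    using \<kappa> U_add U_scale norm_U by (simp add: wigner_symmetry_def)
  then show ?thesis using ray by blast
qed

locale wigner_operator =
  fixes \<kappa> :: "complex \<Rightarrow> complex" and U :: "'a::chilbert_space \<Rightarrow> 'a"
  assumes symmetry: "wigner_symmetry \<kappa> U"
begin

lemma \<kappa>: "\<kappa> = (\<lambda>c. c) \<or> \<kappa> = cnj"
  and U_add: "U (x + y) = U x + U y"
  and U_scaleC: "U (c *\<^sub>C x) = \<kappa> c *\<^sub>C U x"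
  and norm_U: "norm (U x) = norm x"
  and surj_U: "surj U"
  using symmetry by (auto simp: wigner_symmetry_def)

lemma \<kappa>_of_real: "\<kappa> (of_real r) = of_real r"
  using \<kappa> by auto

lemma U_scaleR: "U (r *\<^sub>R x) = r *\<^sub>R U x"
  using U_scaleC[of "of_real r" x] by (simp add: scaleC_of_real \<kappa>_of_real)

lemma bounded_linear_U: "bounded_linear U"
  by (rule bounded_linear_intro[where K = 1]) (simp_all add: U_add U_scaleR norm_U)

lemma U_inner: "U x \<bullet> U y = x \<bullet> y"
proof -
  have "(norm (U (x + y)))\<^sup>2 = (norm (x + y))\<^sup>2" by (simp add: norm_U)
  then have "2 * (U x \<bullet> U y) + ((norm (U x))\<^sup>2 + (norm (U y))\<^sup>2) =
      2 * (x \<bullet> y) + ((norm x)\<^sup>2 + (norm y)\<^sup>2)"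
    unfolding U_add power2_norm_eq_inner by (simp add: inner_add_left inner_add_right inner_commute)
  then show ?thesis by (simp add: norm_U)
qed

lemma U_cinner: "cinner (U x) (U y) = \<kappa> (cinner x y)"
proof (rule complex_eqI)
  show "Re (cinner (U x) (U y)) = Re (\<kappa> (cinner x y))"
    using \<kappa> by (auto simp: Re_cinner U_inner)
  have \<kappa>2: "\<kappa> (\<kappa> \<i>) = \<i>" using \<kappa> by auto
  have "Im (cinner (U x) (U y)) = x \<bullet> (\<kappa> \<i> *\<^sub>C y)"
    using U_inner[of x "\<kappa> \<i> *\<^sub>C y"] by (simp add: Im_cinner U_scaleC \<kappa>2)
  then show "Im (cinner (U x) (U y)) = Im (\<kappa> (cinner x y))"
    using \<kappa> by (auto simp: Im_cinner)
qed

lemma inj_U: "inj U"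
proof (rule injI)
  fix x y assume "U x = U y"
  then have "U (x + (- 1) *\<^sub>R y) = 0" by (simp only: U_add U_scaleR) simp
  then have "norm (x + (- 1) *\<^sub>R y) = 0" using norm_U by (metis norm_zero)
  then show "x = y" by simp
qed

lemma U_inv [simp]: "U (inv U x) = x"
  by (rule surj_f_inv_f[OF surj_U])

lemma inv_U [simp]: "inv U (U x) = x"
  by (rule inv_f_f[OF inj_U])

lemma inv_U_eqI: "x = U y \<Longrightarrow> inv U x = y"
  by simp

lemma wigner_operator_inv: "wigner_operator \<kappa> (inv U)"
proof
  have \<kappa>2: "\<kappa> (\<kappa> c) = c" for c using \<kappa> by auto
  have "inv U (x + y) = inv U x + inv U y" for x y by (rule inv_U_eqI) (simp add: U_add)
  moreover have "inv U (c *\<^sub>C x) = \<kappa> c *\<^sub>C inv U x" for c x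
    by (rule inv_U_eqI) (simp add: U_scaleC \<kappa>2)
  moreover have "norm (inv U x) = norm x" for x using norm_U[of "inv U x"] by simp
  moreover have "surj (inv U)" by (rule surjI) (rule inv_U)
  ultimately show "wigner_symmetry \<kappa> (inv U)" using \<kappa> by (simp add: wigner_symmetry_def)
qed

lemma unitary_or_antiunitary:
  "(unitary U \<and> cadjoint U = inv U) \<or> (antiunitary U \<and> antiadjoint U = inv U)"
  using \<kappa>
proof
  assume id: "\<kappa> = (\<lambda>c. c)"
  have adj: "cadjoint U = inv U"
    using U_cinner[of _ "inv U _"] by (intro cadjoint_eqI) (simp add: id)
  have "bounded_clinear U" using bounded_linear_U U_scaleC by (simp add: bounded_clinear_def id)
  then have "unitary U" by (simp add: unitary_def adj fun_eq_iff)
  then show ?thesis using adj by blast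
next
  assume cnj: "\<kappa> = cnj"
  have adj: "antiadjoint U = inv U"
    using U_cinner[of _ "inv U _"] by (intro antiadjoint_eqI) (simp add: cnj)
  have "bounded_antilinear U" using bounded_linear_U U_scaleC by (simp add: bounded_antilinear_def cnj)
  then have "antiunitary U" by (simp add: antiunitary_def adj fun_eq_iff)
  then show ?thesis using adj by blast
qed

definition conjugate :: "('a \<Rightarrow> 'a) \<Rightarrow> ('a \<Rightarrow> 'a)" where
  "conjugate A = U \<circ> A \<circ> inv U"

lemma conjugate_effect: assumes "A \<in> effects" shows "conjugate A \<in> effects"
proof -
  interpret inv: wigner_operator \<kappa> "inv U" by (rule wigner_operator_inv)
  note sa = effect_self_adjoint[OF assms]
  have \<kappa>2: "\<kappa> (\<kappa> c) = c" for c using \<kappa> by auto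
  have tr: "U x \<bullet> y = x \<bullet> inv U y" for x y using U_inner[of x "inv U y"] by simp
  have "self_adjoint (conjugate A)"
  proof (rule self_adjointI)
    show "bounded_linear (conjugate A)"
      unfolding conjugate_def comp_def
      by (intro bounded_linear_compose[OF bounded_linear_U]
          bounded_linear_compose[OF self_adjoint_bounded[OF sa]] inv.bounded_linear_U)
    show "conjugate A (c *\<^sub>C x) = c *\<^sub>C conjugate A x" for c x
      by (simp add: conjugate_def inv.U_scaleC self_adjoint_scaleC[OF sa] U_scaleC \<kappa>2)
    show "conjugate A x \<bullet> y = x \<bullet> conjugate A y" for x y
      using tr[of "A (inv U x)" y] tr[of "A (inv U y)" x] self_adjoint_inner[OF sa, of "inv U x" "inv U y"]
      by (simp add: conjugate_def inner_commute)
  qed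
  moreover have form: "conjugate A x \<bullet> x = A (inv U x) \<bullet> inv U x" for x
    by (simp add: conjugate_def tr)
  moreover have "conjugate A x \<bullet> x \<le> x \<bullet> x" for x
    using assms inv.U_inner[of x x] unfolding form effects_iff op_le_iff by (metis id_apply)
  ultimately show ?thesis using assms by (simp add: effects_iff positive_def op_le_iff)
qed

lemma conjugate_mono: assumes "A \<preceq> B" shows "conjugate A \<preceq> conjugate B"
proof -
  have tr: "U x \<bullet> y = x \<bullet> inv U y" for x y using U_inner[of x "inv U y"] by simp
  show ?thesis using assms by (simp add: op_le_iff conjugate_def tr)
qed

lemma conjugate_scalar: "conjugate (\<lambda>x. r *\<^sub>R x) = (\<lambda>x. r *\<^sub>R x)"
  by (simp add: conjugate_def fun_eq_iff U_scaleR)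

lemma conjugate_dyad: "conjugate (dyad t q) = dyad t (U q)"
proof
  fix x
  have "cinner x (U q) = \<kappa> (cinner (inv U x) q)" using U_cinner[of "inv U x" q] by simp
  then show "conjugate (dyad t q) x = dyad t (U q) x"
    by (simp add: conjugate_def dyad_def U_scaleR U_scaleC)
qed

end

section \<open>Automorphisms fixing a scalar operator\<close>

text \<open>Above \<open>m I\<close> the dyads of weight at most \<open>m\<close> impose no condition, so the fixed dyads of larger
  weight determine the effect.\<close>

lemma (in order_automorphism) fixes_above_scalar:
  assumes dyads: "\<And>t q. norm q = 1 \<Longrightarrow> 0 < t \<Longrightarrow> m \<le> t \<Longrightarrow> t \<le> 1 \<Longrightarrow> \<phi> (dyad t q) = dyad t q"
    and A: "A \<in> effects" and mA: "(\<lambda>x. m *\<^sub>R x) \<preceq> A" "(\<lambda>x. m *\<^sub>R x) \<preceq> \<phi> A"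
  shows "\<phi> A = A"
proof -
  have iff: "dyad t q \<preceq> A \<longleftrightarrow> dyad t q \<preceq> \<phi> A" if t: "norm q = 1" "0 < t" for t q
  proof (cases "t \<le> m")
    case True
    then have "dyad t q \<preceq> (\<lambda>x. m *\<^sub>R x)" using dyad_le_scalar_iff[OF t(1)] t(2) by simp
    then show ?thesis using mA op_le_trans by blast
  next
    case m: False
    show ?thesis
    proof (cases "t \<le> 1")
      case True
      then have "\<phi> (dyad t q) = dyad t q" using dyads[OF t] m by simp
      moreover have "dyad t q \<in> effects" using True t by (simp add: dyad_effect_iff)
      ultimately show ?thesis using order[OF _ A, of "dyad t q"] by simp
    next
      case False
      have "\<not> dyad t q \<preceq> B" if "B \<in> effects" for B
      proof
        assume "dyad t q \<preceq> B"
        then have "dyad t q \<preceq> id" using that op_le_trans by (auto simp: effects_iff)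
        then show False
          using dyad_le_scalar_iff[OF t(1), of t 1] t(2) False by (simp add: id_def)
      qed
      then show ?thesis using A effect by blast
    qed
  qed
  note pos = effect_positive[OF A] effect_positive[OF effect[OF A]]
  show ?thesis
  proof (rule effects_antisym[OF effect[OF A] A])
    show "\<phi> A \<preceq> A" by (rule op_le_by_dyads[OF pos(2,1)]) (simp add: iff)
    show "A \<preceq> \<phi> A" by (rule op_le_by_dyads[OF pos]) (simp add: iff)
  qed
qed

definition complement :: "('a::chilbert_space \<Rightarrow> 'a) \<Rightarrow> 'a \<Rightarrow> 'a" where
  "complement A = (\<lambda>x. x - A x)"

lemma complement_complement [simp]: "complement (complement A) = A"
  by (simp add: complement_def)

lemma complement_le_iff: "complement A \<preceq> complement B \<longleftrightarrow> B \<preceq> A"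
  by (simp add: complement_def op_le_iff inner_diff_left)

lemma complement_effect:
  assumes "A \<in> effects" shows "complement A \<in> effects"
proof -
  have "self_adjoint (complement A)"
    unfolding complement_def
    using self_adjoint_minus[OF self_adjoint_scalar[of 1] effect_self_adjoint[OF assms]] by simp
  then show ?thesis
    using assms by (simp add: effects_iff positive_def op_le_iff complement_def inner_diff_left)
qed

lemma complement_scalar: "complement (\<lambda>x. r *\<^sub>R x) = (\<lambda>x. (1 - r) *\<^sub>R x)"
  by (simp add: complement_def scaleR_left_diff_distrib)

lemma bij_betw_complement: "bij_betw complement effects effects"
  by (rule bij_betwI[where g = complement]) (auto intro: complement_effect)

lemma (in order_automorphism) dual_automorphism:
  "order_automorphism (\<lambda>A. complement (\<phi> (complement A)))"
proof
  show "bij_betw (\<lambda>A. complement (\<phi> (complement A))) effects effects"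
    using bij_betw_trans[OF bij_betw_trans[OF bij_betw_complement bij] bij_betw_complement]
    by (simp add: comp_def)
  fix A B :: "'a \<Rightarrow> 'a" assume "A \<in> effects" "B \<in> effects"
  then show "A \<preceq> B \<longleftrightarrow> complement (\<phi> (complement A)) \<preceq> complement (\<phi> (complement B))"
    using order[of "complement B" "complement A"] by (simp add: complement_le_iff complement_effect)
qed

text \<open>The fixed dyads of weight at least \<open>l\<close> fix everything above \<open>l I\<close>.  In the dual automorphism
  these are the operators below \<open>(1 - l) I\<close>, in particular a nonzero operator on each line, so
  that its action on lines is trivial; by \<open>image_dyad_above_l\<close> the dual fixes the remaining
  dyads as well.\<close>

lemma (in scalar_fixing_automorphism) identity_if_fixes_heavy_dyads:
  assumes dyads: "\<And>t q. norm q = 1 \<Longrightarrow> l \<le> t \<Longrightarrow> t \<le> 1 \<Longrightarrow> \<phi> (dyad t q) = dyad t q"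
    and A: "A \<in> effects"
  shows "\<phi> A = A"
proof -
  have above: "\<phi> A = A" if A: "A \<in> effects" "(\<lambda>x. l *\<^sub>R x) \<preceq> A" for A
  proof (rule fixes_above_scalar[OF _ A])
    show "(\<lambda>x. l *\<^sub>R x) \<preceq> \<phi> A" using order[OF fixed_scalar_effect A(1)] A(2) fixed by simp
  qed (rule dyads)
  define \<delta> where "\<delta> = (\<lambda>A. complement (\<phi> (complement A)))"
  interpret dual: scalar_fixing_automorphism \<delta> "1 - l"
  proof (intro scalar_fixing_automorphism.intro scalar_fixing_automorphism_axioms.intro)
    show "order_automorphism \<delta>" unfolding \<delta>_def by (rule dual_automorphism)
    show "0 < 1 - l" "1 - l < 1" using l by simp_all
    show "\<delta> (\<lambda>x. (1 - l) *\<^sub>R x) = (\<lambda>x. (1 - l) *\<^sub>R x)"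
      by (simp add: \<delta>_def complement_scalar fixed)
  qed (rule two_dimensional)
  have low: "\<delta> (dyad t q) = dyad t q" if q: "norm q = 1" and t: "0 \<le> t" "t \<le> 1 - l" for t q
  proof -
    have e: "complement (dyad t q) \<in> effects"
      using q t l by (intro complement_effect) (simp add: dyad_effect_iff)
    have "dyad t q \<preceq> (\<lambda>x. (1 - l) *\<^sub>R x)" using dyad_le_scalar_iff[OF q t(1)] t(2) by blast
    then have "(\<lambda>x. l *\<^sub>R x) \<preceq> complement (dyad t q)"
      using complement_le_iff[of "\<lambda>x. (1 - l) *\<^sub>R x" "dyad t q"] by (simp add: complement_scalar)
    then show ?thesis using above[OF e] by (simp add: \<delta>_def)
  qed
  have all: "\<delta> (dyad t q) = dyad t q" if q: "norm q = 1" and t: "0 < t" "t \<le> 1" for t q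
  proof (cases "t \<le> 1 - l")
    case False
    have line: "dyad (1 - l) q = dyad (1 - l) (dual.image_unit q)"
      using low[OF q, of "1 - l"] dual.image_dyad_above_l[OF q, of "1 - l"] l by simp
    have eq: "(1 - l) *\<^sub>R (cinner x q *\<^sub>C q) =
        (1 - l) *\<^sub>R (cinner x (dual.image_unit q) *\<^sub>C dual.image_unit q)" for x
      using fun_cong[OF line, of x] by (simp only: dyad_def)
    have "1 - l \<noteq> 0" using l by simp
    then have "cinner x q *\<^sub>C q = cinner x (dual.image_unit q) *\<^sub>C dual.image_unit q" for x
      using eq[of x] by (rule scaleR_left_imp_eq)
    then have "dyad t q = dyad t (dual.image_unit q)" by (simp add: dyad_def fun_eq_iff)
    then show ?thesis using dual.image_dyad_above_l[OF q, of t] t False by simp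
  qed (use low[OF q] t in simp)
  have "\<delta> (complement A) = complement A"
  proof (rule dual.fixes_above_scalar[where m = 0])
    show "(\<lambda>x. 0 *\<^sub>R x) \<preceq> complement A" "(\<lambda>x. 0 *\<^sub>R x) \<preceq> \<delta> (complement A)"
      using complement_effect[OF A] dual.effect[OF complement_effect[OF A]]
      by (simp_all add: effects_def)
  qed (use all complement_effect[OF A] in auto)
  then show ?thesis unfolding \<delta>_def by (metis complement_complement)
qed

lemma (in wigner_operator) bij_betw_conjugate: "bij_betw conjugate effects effects"
proof -
  interpret inv: wigner_operator \<kappa> "inv U" by (rule wigner_operator_inv)
  have "inv (inv U) = U" by (rule inv_inv_eq) (simp add: bij_def inj_U surj_U)
  then have "inv.conjugate (conjugate A) = A" "conjugate (inv.conjugate A) = A" for A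
    by (simp_all add: conjugate_def inv.conjugate_def fun_eq_iff)
  then show ?thesis
    by (intro bij_betwI[where g = inv.conjugate]) (auto intro: conjugate_effect inv.conjugate_effect)
qed

lemma exists_orthogonal_unit:
  fixes q :: "'a::chilbert_space" and B :: "'a set"
  assumes B: "orthonormal_basis B" "infinite B \<or> 2 \<le> card B" and q: "norm q = 1"
  shows "\<exists>e. norm e = 1 \<and> cinner q e = 0"
proof -
  obtain b c where bc: "b \<in> B" "c \<in> B" "b \<noteq> c"
  proof -
    have "B \<noteq> {}" using B(2) by auto
    then obtain b where b: "b \<in> B" by blast
    have "B \<noteq> {b}" using B(2) by auto
    then obtain c where "c \<in> B" "b \<noteq> c" using b by blast
    with b show ?thesis by (rule that)
  qed
  then have orth: "cinner b c = 0" "cinner b b = 1" "cinner c c = 1"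
    using B(1) by (auto simp: orthonormal_basis_def)
  have "b \<noteq> cinner b q *\<^sub>C q \<or> c \<noteq> cinner c q *\<^sub>C q"
  proof (rule ccontr)
    assume parallel: "\<not> (b \<noteq> cinner b q *\<^sub>C q \<or> c \<noteq> cinner c q *\<^sub>C q)"
    have b: "b = cinner b q *\<^sub>C q" using parallel by (rule contrapos_np) (rule disjI1)
    have c: "c = cinner c q *\<^sub>C q" using parallel by (rule contrapos_np) (rule disjI2)
    have "cinner b c = cinner b q * cnj (cinner c q)"
    proof -
      have "cinner (cinner b q *\<^sub>C q) (cinner c q *\<^sub>C q) = cinner b q * cnj (cinner c q)"
        by (simp add: cinner_scaleC_left cinner_scaleC_right cinner_self_unit[OF q])
      then show ?thesis unfolding b[symmetric] c[symmetric] .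
    qed
    moreover have "cinner b q \<noteq> 0"
    proof
      assume "cinner b q = 0"
      then have "cinner b q *\<^sub>C q = 0" by simp
      then show False using orth(2) unfolding b[symmetric] by simp
    qed
    moreover have "cinner c q \<noteq> 0"
    proof
      assume "cinner c q = 0"
      then have "cinner c q *\<^sub>C q = 0" by simp
      then show False using orth(3) unfolding c[symmetric] by simp
    qed
    ultimately show False using orth(1) by simp
  qed
  then obtain v where "v - cinner v q *\<^sub>C q \<noteq> 0" by auto
  moreover define w where "w = v - cinner v q *\<^sub>C q"
  moreover have "cinner w q = 0"
    by (simp add: w_def cinner_algebra cinner_self_unit[OF q])
  ultimately have "norm (w /\<^sub>R norm w) = 1" "cinner q (w /\<^sub>R norm w) = 0"
    using cinner_commute[of q w] by (simp_all add: cinner_scaleR_right)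
  then show ?thesis by blast
qed

text \<open>Wigner's theorem is applied to the positively homogeneous extension of \<open>image_unit\<close> to all
  vectors.\<close>

lemma (in scalar_fixing_automorphism) exists_wigner_operator:
  assumes e: "norm (e::'a) = 1"
  shows "\<exists>\<kappa> U. wigner_symmetry \<kappa> U \<and>
    (\<forall>t q. norm q = 1 \<longrightarrow> dyad t (image_unit q) = dyad t (U q))"
proof -
  define \<Psi> where "\<Psi> = (\<lambda>x. norm x *\<^sub>R image_unit (x /\<^sub>R norm x))"
  have pres: "cmod (cinner (\<Psi> x) (\<Psi> y)) = cmod (cinner x y)" for x y
  proof (cases "x = 0 \<or> y = 0")
    case False
    then have "cmod (cinner (\<Psi> x) (\<Psi> y)) =
        norm x * norm y * cmod (cinner (x /\<^sub>R norm x) (y /\<^sub>R norm y))"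
      using transition_preserved[of "x /\<^sub>R norm x" "y /\<^sub>R norm y"]
      by (simp add: \<Psi>_def cinner_scaleR_left[of "norm x"] cinner_scaleR_right[of _ "norm y"] norm_mult)
    also have "\<dots> = cmod (cinner x y)"
      using False by (simp add: cinner_scaleR_left cinner_scaleR_right norm_mult norm_divide field_simps)
    finally show ?thesis .
  qed (auto simp: \<Psi>_def)
  have \<Psi>_unit: "\<Psi> q = image_unit q" if "norm q = 1" for q using that by (simp add: \<Psi>_def)
  have onto: "\<exists>c x. y = c *\<^sub>C \<Psi> x" for y
  proof (cases "y = 0")
    case True
    then have "y = 0 *\<^sub>C \<Psi> 0" by simp
    then show ?thesis by blast
  next
    case False
    define q where "q = y /\<^sub>R norm y"
    have q: "norm q = 1" "y = norm y *\<^sub>R q" using False by (simp_all add: q_def)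
    obtain s r where sr: "norm r = 1" "0 \<le> s" "s \<le> 1" "\<phi> (dyad s r) = dyad 1 q"
      using onto_dyad[OF q(1) zero_le_one order_refl] by (elim exE conjE) (rule that)
    have "dyad s r \<in> effects" "dyad 1 r \<in> effects" using sr by (simp_all add: dyad_effect_iff)
    then have "dyad 1 q \<preceq> dyad 1 (image_unit r)"
      using order[of "dyad s r" "dyad 1 r"] dyad_le_dyad[OF sr(3), of r] image_unit(2)[OF sr(1)] sr(4)
      by simp
    then have "q = cinner q (image_unit r) *\<^sub>C \<Psi> r"
      using dyad_le_dyad_imp_parallel[OF zero_less_one _ image_unit(1)[OF sr(1)]] \<Psi>_unit[OF sr(1)]
      by simp
    then have "y = (norm y * cinner q (image_unit r)) *\<^sub>C \<Psi> r"
      using q(2) by (simp only: scaleC_of_real_mult)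
    then show ?thesis by blast
  qed
  obtain \<kappa> U where U: "wigner_symmetry \<kappa> U" and ray: "\<And>x. \<exists>c. cmod c = 1 \<and> \<Psi> x = c *\<^sub>C U x"
    using wigner[of \<Psi>, OF pres onto e] by blast
  have "dyad t (image_unit q) = dyad t (U q)" if "norm q = 1" for t q
  proof -
    obtain c where "cmod c = 1" "\<Psi> q = c *\<^sub>C U q" using ray[of q] by blast
    then show ?thesis using \<Psi>_unit[OF that] by (metis dyad_phase)
  qed
  then show ?thesis using U by (intro exI[of _ \<kappa>] exI[of _ U]) blast
qed

theorem corollary4:
  fixes \<phi> :: "('a::chilbert_space \<Rightarrow> 'a) \<Rightarrow> ('a \<Rightarrow> 'a)" and l :: real
  assumes "\<exists>B :: 'a set. orthonormal_basis B \<and> (infinite B \<or> 2 \<le> card B)"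
    and "bij_betw \<phi> effects effects"
    and "\<And>A B. A \<in> effects \<Longrightarrow> B \<in> effects \<Longrightarrow> A \<preceq> B \<longleftrightarrow> \<phi> A \<preceq> \<phi> B"
    and "0 < l" "l < 1"
    and "\<phi> (\<lambda>x. l *\<^sub>R x) = (\<lambda>x. l *\<^sub>R x)"
  shows "\<exists>U. (unitary U \<and> (\<forall>A\<in>effects. \<phi> A = U \<circ> A \<circ> cadjoint U)) \<or>
             (antiunitary U \<and> (\<forall>A\<in>effects. \<phi> A = U \<circ> A \<circ> antiadjoint U))"
proof -
  obtain B :: "'a set" where B: "orthonormal_basis B" "infinite B \<or> 2 \<le> card B"
    using assms(1) by blast
  have "B \<noteq> {}" using B(2) by auto
  then obtain e where "e \<in> B" by blast
  then have "cinner e e = 1" using B(1) by (simp add: orthonormal_basis_def)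
  then have "complex_of_real ((norm e)\<^sup>2) = 1" by (simp only: cinner_self)
  then have e: "norm e = 1"
    by (simp only: of_real_eq_1_iff power2_eq_1_iff) (smt (verit) norm_ge_zero)
  note two_dim = exists_orthogonal_unit[OF B]
  interpret scalar_fixing_automorphism \<phi> l
    by unfold_locales (use assms(2-6) two_dim in auto)
  obtain \<kappa> U where U: "wigner_symmetry \<kappa> U"
    and ray: "\<And>t q. norm q = 1 \<Longrightarrow> dyad t (image_unit q) = dyad t (U q)"
    using exists_wigner_operator[OF e] by (elim exE conjE) (rule that, auto)
  interpret U: wigner_operator \<kappa> U by unfold_locales (rule U)
  interpret inv: wigner_operator \<kappa> "inv U" by (rule U.wigner_operator_inv)
  have inv_inv: "inv (inv U) = U" by (rule inv_inv_eq) (simp add: bij_def U.inj_U U.surj_U)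
  have cancel: "U.conjugate (inv.conjugate A) = A" for A
    by (simp add: U.conjugate_def inv.conjugate_def inv_inv fun_eq_iff)
  interpret reduced: scalar_fixing_automorphism "\<lambda>A. inv.conjugate (\<phi> A)" l
  proof
    show "bij_betw (\<lambda>A. inv.conjugate (\<phi> A)) effects effects"
      using bij_betw_trans[OF bij inv.bij_betw_conjugate] by (simp add: comp_def)
    fix A B :: "'a \<Rightarrow> 'a" assume AB: "A \<in> effects" "B \<in> effects"
    show "A \<preceq> B \<longleftrightarrow> inv.conjugate (\<phi> A) \<preceq> inv.conjugate (\<phi> B)"
      using order[OF AB] inv.conjugate_mono[of "\<phi> A" "\<phi> B"]
        U.conjugate_mono[of "inv.conjugate (\<phi> A)" "inv.conjugate (\<phi> B)"]
      by (auto simp: cancel)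
  qed (use l two_dim in \<open>auto simp: fixed inv.conjugate_scalar\<close>)
  have "inv.conjugate (\<phi> A) = A" if "A \<in> effects" for A
  proof (rule reduced.identity_if_fixes_heavy_dyads[OF _ that])
    fix t and q :: 'a assume "norm q = 1" "l \<le> t" "t \<le> 1"
    then show "inv.conjugate (\<phi> (dyad t q)) = dyad t q"
      by (simp add: image_dyad_above_l ray inv.conjugate_dyad)
  qed
  then have "\<phi> A = U \<circ> A \<circ> inv U" if "A \<in> effects" for A
    using cancel[of "\<phi> A"] that by (simp add: U.conjugate_def)
  then show ?thesis using U.unitary_or_antiunitary by (intro exI[of _ U]) auto
qed

end
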